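(* Let the plant graph $G_{\mathcal P}$ contain at least one sink, the design graph $G_{\mathcal C}$ be a totally disconnected graph, and $G_{\mathcal K}\supseteq G_{\mathcal P}$. Then the control design method $\Gamma^\Theta$ is undominated by all limited model information control design methods, i.e. $\Gamma^\Theta$ is undominated in $\mathcal C$ for plants in $\mathcal P$.
   Context: Fix $n\ge2$, $\epsilon>0$, and directed graphs on $\{1,\dots,n\}$: a plant graph $G_{\mathcal P}$ (no isolated node), a control graph $G_{\mathcal K}$ and a design graph $G_{\mathcal C}$ (both containing all self-loops). The adjacency matrix $S$ of a graph with edge set $E$ has $s_{ij}=1$ if $(j,i)\in E$ and $0$ otherwise; $S_{\mathcal P},S_{\mathcal K},S_{\mathcal C}$ are those of the three graphs. $G'\supseteq G$ means the edge set of $G'$ contains that of $G$. Node $i$ is a sink if there is no $j\ne i$ with $(i,j)\in E$. $G_{\mathcal C}$ totally disconnected means its only edges are the self-loops. Let $c\ge1$ be the number of sinks of $G_{\mathcal P}$, numbered so that the sinks are exactly $n-c+1,\dots,n$. Plants: $\mathcal P$ is the set of tuples $P=(A,B,D,x_0,w_0)$ with $A\in\mathcal A(S_{\mathcal P})=\{\bar A\in\mathbb R^{n\times n}:\bar a_{ij}=0\text{ if }(s_{\mathcal P})_{ij}=0\}$; $B\in\mathcal B(\epsilon)$ (real diagonal $n\times n$ matrices with smallest singular value at least $\epsilon$); $D\in\mathcal D$ (real diagonal $n\times n$ matrices); $x_0,w_0\in\mathbb R^n$. Such a $P$ represents $$x(k+1)=Ax(k)+B(u(k)+w(k)),\ x(0)=x_0;\qquad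 w(k+1)=Dw(k),\ w(0)=w_0.$$ Controllers: $\mathcal K=\mathcal K(S_{\mathcal K})$ is the set of $n\times n$ matrices $K$ of proper real rational functions with $k_{ij}=0$ whenever $(s_{\mathcal K})_{ij}=0$; $K=\left[\begin{array}{c|c}A_K&B_K\\ \hline C_K&D_K\end{array}\right]=C_K(zI-A_K)^{-1}B_K+D_K$ acts as $x_K(k+1)=A_Kx_K(k)+B_Kx(k)$, $x_K(0)=0$, $u(k)=C_Kx_K(k)+D_Kx(k)$. Design strategies: a control design method is a map $\Gamma:\mathcal A(S_{\mathcal P})\times\mathcal B(\epsilon)\times\mathcal D\to\mathcal K(S_{\mathcal K})$, with realization matrices $A_\Gamma,B_\Gamma,C_\Gamma,D_\Gamma$ depending on $(A,B,D)$ ($A_\Gamma,C_\Gamma$ block diagonal, since subcontrollers do not share state variables). $\mathcal C$ is the set of design methods with structure $G_{\mathcal C}$: for every $i$, the $i$-th row $\Gamma_i$ is a function only of $\{[a_{j1}\cdots a_{jn}],b_{jj},d_{jj}:(s_{\mathcal C})_{ij}\ne0\}$. Cost: $J_P(K)=\sum_{k=0}^\infty[x(k)^Tx(k)+(u(k)+w(k))^T(u(k)+w(k))]$. Domination: $\Gamma$ dominates $\Gamma'$ if $J_P(\Gamma(A,B,D))\le J_P(\Gamma'(A,B,D))$ for all $P=(A,B,D,x_0,w_0)\in\mathcal P$, with strict inequality for at least one plant in $\mathcal P$. $\Gamma'\in\mathcal C$ is undominated in $\mathcal C$ for plants in $\mathcal P$ if no $\Gamma\in\mathcal C$ dominates it.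 The method $\Gamma^\Theta$ (deadbeat on every non-sink, and on every sink the same optimal control law as if the node were isolated) is $$\Gamma^\Theta(A,B,D)=\left[\begin{array}{c|c}D&B^{-1}D(F(A,B)+I)A-B^{-1}D^2\\ \hline I&B^{-1}(F(A,B)A-D)\end{array}\right],$$ $$F(A,B)=\mathrm{diag}(-1,\dots,-1,f_{n-c+1}(A,B),\dots,f_n(A,B)),$$ $$f_i(A,B)=\frac{2}{b_{ii}^2+a_{ii}^2+1+\sqrt{a_{ii}^4+2a_{ii}^2b_{ii}^2-2a_{ii}^2+b_{ii}^4+2b_{ii}^2+1}}-1,\quad i=n-c+1,\dots,n.$$ *)

theory Defs
  imports
    "Jordan_Normal_Form.Char_Poly"
    "Jordan_Normal_Form.Gauss_Jordan_Elimination"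
    "HOL-Computational_Algebra.Polynomial_Factorial"
    "HOL-Library.Extended_Nonnegative_Real"
begin

text \<open>Nodes and matrix indices are \<open>0, \<dots>, n - 1\<close>, so the sinks that are numbered
  \<open>n - c + 1, \<dots>, n\<close> in one-based counting form the set \<open>{n - c..<n}\<close>.
  A directed graph is given by its edge set; self-loops are allowed.\<close>

definition digraph_on :: "nat \<Rightarrow> (nat \<times> nat) set \<Rightarrow> bool" where
  "digraph_on n E \<longleftrightarrow> E \<subseteq> {..<n} \<times> {..<n}"

text \<open>Note the transposition: entry \<open>(i,j)\<close> belongs to the edge from \<open>j\<close> to \<open>i\<close>.\<close>

definition adjacency_mat :: "nat \<Rightarrow> (nat \<times> nat) set \<Rightarrow> real mat" where
  "adjacency_mat n E = mat n n (\<lambda>(i, j). if (j, i) \<in> E then 1 else 0)"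

definition all_self_loops :: "nat \<Rightarrow> (nat \<times> nat) set \<Rightarrow> bool" where
  "all_self_loops n E \<longleftrightarrow> (\<forall>i<n. (i, i) \<in> E)"

text \<open>A self-loop alone does not prevent a node from being isolated.\<close>

definition isolated_node :: "nat \<Rightarrow> (nat \<times> nat) set \<Rightarrow> nat \<Rightarrow> bool" where
  "isolated_node n E i \<longleftrightarrow> i < n \<and> \<not> (\<exists>j. j \<noteq> i \<and> ((i, j) \<in> E \<or> (j, i) \<in> E))"

definition sinks :: "nat \<Rightarrow> (nat \<times> nat) set \<Rightarrow> nat set" where
  "sinks n E = {i. i < n \<and> \<not> (\<exists>j. j \<noteq> i \<and> (i, j) \<in> E)}"

definition totally_disconnected :: "nat \<Rightarrow> (nat \<times> nat) set \<Rightarrow> bool" where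
  "totally_disconnected n E \<longleftrightarrow> E = {(i, i) | i. i < n}"

definition A_class :: "nat \<Rightarrow> real mat \<Rightarrow> real mat set" where
  "A_class n S = {A \<in> carrier_mat n n. \<forall>i<n. \<forall>j<n. S $$ (i, j) = 0 \<longrightarrow> A $$ (i, j) = 0}"

definition singular_values :: "real mat \<Rightarrow> real set" where
  "singular_values M = {sqrt t | t. eigenvalue (transpose_mat M * M) t}"

definition smallest_singular_value :: "real mat \<Rightarrow> real" where
  "smallest_singular_value M = Min (singular_values M)"

definition B_class :: "nat \<Rightarrow> real \<Rightarrow> real mat set" where
  "B_class n \<epsilon> = {B \<in> carrier_mat n n. diagonal_mat B \<and> \<epsilon> \<le> smallest_singular_value B}"

definition D_class :: "nat \<Rightarrow> real mat set" where
  "D_class n = {D \<in> carrier_mat n n. diagonal_mat D}"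

type_synonym plant = "real mat \<times> real mat \<times> real mat \<times> real vec \<times> real vec"

definition plants :: "nat \<Rightarrow> real \<Rightarrow> (nat \<times> nat) set \<Rightarrow> plant set" where
  "plants n \<epsilon> EP = A_class n (adjacency_mat n EP) \<times> B_class n \<epsilon> \<times> D_class n
     \<times> carrier_vec n \<times> carrier_vec n"

text \<open>Real rational functions in \<open>z\<close> are elements of \<open>real poly fract\<close>.\<close>

type_synonym ratfun = "real poly fract"

definition proper :: "ratfun \<Rightarrow> bool" where
  "proper f \<longleftrightarrow> (\<exists>p q. q \<noteq> 0 \<and> degree p \<le> degree q \<and> f = Fract p q)"

definition controllers :: "nat \<Rightarrow> real mat \<Rightarrow> ratfun mat set" where
  "controllers n S = {K \<in> carrier_mat n n. \<forall>i<n. \<forall>j<n.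
     proper (K $$ (i, j)) \<and> (S $$ (i, j) = 0 \<longrightarrow> K $$ (i, j) = 0)}"

text \<open>Used for invertible matrices only.\<close>

abbreviation mat_inv :: "'a::field mat \<Rightarrow> 'a mat" where
  "mat_inv M \<equiv> the (mat_inverse M)"

abbreviation const_mat :: "real mat \<Rightarrow> ratfun mat" where
  "const_mat \<equiv> map_mat (\<lambda>r. to_fract [:r:])"

abbreviation z_var :: ratfun where
  "z_var \<equiv> to_fract [:0, 1:]"

definition transfer_matrix :: "real mat \<Rightarrow> real mat \<Rightarrow> real mat \<Rightarrow> real mat \<Rightarrow> ratfun mat" where
  "transfer_matrix AK BK CK DK =
     const_mat CK * mat_inv (z_var \<cdot>\<^sub>m 1\<^sub>m (dim_row AK) - const_mat AK) * const_mat BK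
       + const_mat DK"

text \<open>The state dimension \<open>r\<close> is arbitrary; \<open>r = 0\<close> is a static controller.\<close>

definition realizes ::
  "nat \<Rightarrow> ratfun mat \<Rightarrow> real mat \<Rightarrow> real mat \<Rightarrow> real mat \<Rightarrow> real mat \<Rightarrow> bool" where
  "realizes n K AK BK CK DK \<longleftrightarrow>
     (\<exists>r. AK \<in> carrier_mat r r \<and> BK \<in> carrier_mat r n \<and>
          CK \<in> carrier_mat n r \<and> DK \<in> carrier_mat n n) \<and>
     K = transfer_matrix AK BK CK DK"

text \<open>Subcontroller \<open>i\<close> has its own state, with dynamics \<open>As ! i\<close> and output row \<open>Cs ! i\<close>;
  its dimension may be zero.\<close>

definition block_diagonal_realization :: "nat \<Rightarrow> real mat \<Rightarrow> real mat \<Rightarrow> bool" where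
  "block_diagonal_realization n AK CK \<longleftrightarrow>
     (\<exists>As Cs. length As = n \<and> length Cs = n \<and>
        (\<forall>i<n. square_mat (As ! i) \<and> Cs ! i \<in> carrier_mat 1 (dim_row (As ! i))) \<and>
        AK = diag_block_mat As \<and> CK = diag_block_mat Cs)"

definition closed_loop ::
  "plant \<Rightarrow> real mat \<Rightarrow> real mat \<Rightarrow> real mat \<Rightarrow> real mat \<Rightarrow>
   (nat \<Rightarrow> real vec) \<Rightarrow> (nat \<Rightarrow> real vec) \<Rightarrow> (nat \<Rightarrow> real vec) \<Rightarrow> (nat \<Rightarrow> real vec) \<Rightarrow> bool" where
  "closed_loop P AK BK CK DK x w xK u \<longleftrightarrow> (case P of (A, B, D, x0, w0) \<Rightarrow>
     x 0 = x0 \<and> w 0 = w0 \<and> xK 0 = 0\<^sub>v (dim_row AK) \<and>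
     (\<forall>k. x (Suc k) = A *\<^sub>v x k + B *\<^sub>v (u k + w k) \<and>
          w (Suc k) = D *\<^sub>v w k \<and>
          xK (Suc k) = AK *\<^sub>v xK k + BK *\<^sub>v x k \<and>
          u k = CK *\<^sub>v xK k + DK *\<^sub>v x k))"

text \<open>The closed-loop signals \<open>x\<close>, \<open>u\<close>, \<open>w\<close> do not depend on the chosen realization of \<open>K\<close>,
  because the controller starts in state zero. A divergent sum is the cost \<open>\<infinity>\<close>.\<close>

definition cost :: "nat \<Rightarrow> plant \<Rightarrow> ratfun mat \<Rightarrow> ennreal" where
  "cost n P K = (THE J. \<exists>AK BK CK DK x w xK u.
     realizes n K AK BK CK DK \<and> closed_loop P AK BK CK DK x w xK u \<and>
     J = (\<Sum>k. ennreal (x k \<bullet> x k + (u k + w k) \<bullet> (u k + w k))))"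

text \<open>Only the values on \<open>\<A>(S\<^sub>P) \<times> \<B>(\<epsilon>) \<times> \<D>\<close> matter.\<close>

type_synonym design_method = "real mat \<Rightarrow> real mat \<Rightarrow> real mat \<Rightarrow> ratfun mat"

definition design_methods ::
  "nat \<Rightarrow> real \<Rightarrow> (nat \<times> nat) set \<Rightarrow> (nat \<times> nat) set \<Rightarrow> design_method set" where
  "design_methods n \<epsilon> EP EK = {\<Gamma>.
     \<forall>A \<in> A_class n (adjacency_mat n EP). \<forall>B \<in> B_class n \<epsilon>. \<forall>D \<in> D_class n.
       \<Gamma> A B D \<in> controllers n (adjacency_mat n EK) \<and>
       (\<exists>A\<^sub>\<Gamma> B\<^sub>\<Gamma> C\<^sub>\<Gamma> D\<^sub>\<Gamma>. realizes n (\<Gamma> A B D) A\<^sub>\<Gamma> B\<^sub>\<Gamma> C\<^sub>\<Gamma> D\<^sub>\<Gamma> \<and>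
          block_diagonal_realization n A\<^sub>\<Gamma> C\<^sub>\<Gamma>)}"

text \<open>``Row \<open>i\<close> is a function only of the listed data'' is expressed by: two plants of the class
  that agree in these data yield the same row \<open>i\<close>.\<close>

definition has_design_structure ::
  "nat \<Rightarrow> real \<Rightarrow> (nat \<times> nat) set \<Rightarrow> (nat \<times> nat) set \<Rightarrow> design_method \<Rightarrow> bool" where
  "has_design_structure n \<epsilon> EP EC \<Gamma> \<longleftrightarrow>
     (\<forall>A \<in> A_class n (adjacency_mat n EP). \<forall>A' \<in> A_class n (adjacency_mat n EP).
      \<forall>B \<in> B_class n \<epsilon>. \<forall>B' \<in> B_class n \<epsilon>. \<forall>D \<in> D_class n. \<forall>D' \<in> D_class n. \<forall>i<n.
        (\<forall>j<n. adjacency_mat n EC $$ (i, j) \<noteq> 0 \<longrightarrow>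
           row A j = row A' j \<and> B $$ (j, j) = B' $$ (j, j) \<and> D $$ (j, j) = D' $$ (j, j)) \<longrightarrow>
        row (\<Gamma> A B D) i = row (\<Gamma> A' B' D') i)"

definition structured_design_methods ::
  "nat \<Rightarrow> real \<Rightarrow> (nat \<times> nat) set \<Rightarrow> (nat \<times> nat) set \<Rightarrow> (nat \<times> nat) set \<Rightarrow> design_method set"
  where
  "structured_design_methods n \<epsilon> EP EK EC =
     {\<Gamma> \<in> design_methods n \<epsilon> EP EK. has_design_structure n \<epsilon> EP EC \<Gamma>}"

definition dominates ::
  "nat \<Rightarrow> real \<Rightarrow> (nat \<times> nat) set \<Rightarrow> design_method \<Rightarrow> design_method \<Rightarrow> bool" where
  "dominates n \<epsilon> EP \<Gamma> \<Gamma>' \<longleftrightarrow>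
     (\<forall>(A, B, D, x0, w0) \<in> plants n \<epsilon> EP.
        cost n (A, B, D, x0, w0) (\<Gamma> A B D) \<le> cost n (A, B, D, x0, w0) (\<Gamma>' A B D)) \<and>
     (\<exists>(A, B, D, x0, w0) \<in> plants n \<epsilon> EP.
        cost n (A, B, D, x0, w0) (\<Gamma> A B D) < cost n (A, B, D, x0, w0) (\<Gamma>' A B D))"

definition undominated ::
  "nat \<Rightarrow> real \<Rightarrow> (nat \<times> nat) set \<Rightarrow> (nat \<times> nat) set \<Rightarrow> (nat \<times> nat) set \<Rightarrow> design_method \<Rightarrow> bool"
  where
  "undominated n \<epsilon> EP EK EC \<Gamma>' \<longleftrightarrow>
     \<Gamma>' \<in> structured_design_methods n \<epsilon> EP EK EC \<and>
     \<not> (\<exists>\<Gamma> \<in> structured_design_methods n \<epsilon> EP EK EC. dominates n \<epsilon> EP \<Gamma> \<Gamma>')"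

definition sink_gain :: "real mat \<Rightarrow> real mat \<Rightarrow> nat \<Rightarrow> real" where
  "sink_gain A B i = (let a = A $$ (i, i); b = B $$ (i, i) in
     2 / (b^2 + a^2 + 1 + sqrt (a^4 + 2 * a^2 * b^2 - 2 * a^2 + b^4 + 2 * b^2 + 1)) - 1)"

definition F_mat :: "nat \<Rightarrow> nat \<Rightarrow> real mat \<Rightarrow> real mat \<Rightarrow> real mat" where
  "F_mat n c A B = mat_diag n (\<lambda>i. if i < n - c then -1 else sink_gain A B i)"

definition Gamma_Theta :: "nat \<Rightarrow> nat \<Rightarrow> design_method" where
  "Gamma_Theta n c A B D = transfer_matrix
     D (mat_inv B * D * (F_mat n c A B + 1\<^sub>m n) * A - mat_inv B * (D * D))
     (1\<^sub>m n) (mat_inv B * (F_mat n c A B * A - D))"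

end

theory Submission
  imports Defs
begin

text \<open>The closed-loop signals depend on a controller only through the coefficients of its transfer
  matrix in powers of \<open>1/z\<close> (its Markov parameters), so it suffices to show that a method \<open>\<Gamma>\<close>
  that is never more expensive than \<open>Gamma_Theta\<close> has the same Markov parameters, row by row.
  Take the first coefficient of row \<open>i\<close> that differs. Since row \<open>i\<close> sees only its own data, the
  remaining rows of the plant can be chosen adversarially, with \<open>w\<^sub>0 = B\<^sup>-\<^sup>1 D x\<^sub>0\<close>; then
  \<open>Gamma_Theta\<close> cancels the disturbance from the start. If \<open>i\<close> is not a sink, the deviation
  makes \<open>x\<^sub>i(k + 1)\<close> nonzero, where \<open>Gamma_Theta\<close> has \<open>0\<close>, and an edge \<open>i \<rightarrow> j\<close> with large gain
  makes this arbitrarily expensive. If \<open>i\<close> is a sink, all other rows are set to zero and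
  \<open>Gamma_Theta\<close> is the unique optimum of a scalar linear quadratic problem.\<close>

section \<open>Markov parameters of a transfer matrix\<close>

text \<open>Why one coefficient can be isolated: if all earlier coefficients of row i agree and x0
  is the m-th unit vector, the input of node i at time k deviates by exactly the difference of the
  coefficients in column m. Later states enter the convolution only through coefficients of lower
  index, so the other rows cannot blur it. Why the probe has two parameters: for m = i the initial
  state already pushes node j by r. \<open>Gamma_Theta\<close> may spend r^2/b^2 there, while a
  competitor is only known to spend r^2/(1+b^2). This possible saving must stay below the loss r^2
  X^2/(1+b^2) caused by a deviation X, which holds once b^2 X^2 > 1. So b is fixed first, and only
  then does r grow. Why non-sinks come first: the problem of a sink becomes scalar only if all
  non-sinks rest after time 0, under the competitor too. This follows once their rows are known to
  agree with \<open>Gamma_Theta\<close> on every plant. The other sinks cannot disturb, since no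
  edge leads from one sink to another.\<close>

text \<open>A bound on the degree at infinity. Asking for some representation, not a reduced one,
  lets 0 satisfy every bound (by a denominator of high degree) and spares all cancellation.\<close>

definition fdeg_le :: "ratfun \<Rightarrow> int \<Rightarrow> bool" where
  "fdeg_le f m \<longleftrightarrow> (\<exists>p q. q \<noteq> 0 \<and> f = Fract p q \<and> int (degree p) \<le> int (degree q) + m)"

abbreviation const_ratfun :: "real \<Rightarrow> ratfun" where
  "const_ratfun r \<equiv> to_fract [:r:]"

lemma fdeg_le_mono: "fdeg_le f m \<Longrightarrow> m \<le> m' \<Longrightarrow> fdeg_le f m'"
  unfolding fdeg_le_def by force

lemma fdeg_le_exists: "\<exists>m::nat. fdeg_le f (int m)"
proof (cases f rule: Fract_cases)
  case (Fract p q)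
  then show ?thesis unfolding fdeg_le_def
    by (intro exI[of _ "degree p"] exI[of _ p] exI[of _ q]) auto
qed

lemma fdeg_le_add:
  assumes "fdeg_le f m" "fdeg_le g m"
  shows "fdeg_le (f + g) m"
proof -
  obtain p q where f: "q \<noteq> 0" "f = Fract p q" "int (degree p) \<le> int (degree q) + m"
    using assms(1) fdeg_le_def by blast
  obtain p' q' where g: "q' \<noteq> 0" "g = Fract p' q'" "int (degree p') \<le> int (degree q') + m"
    using assms(2) fdeg_le_def by blast
  have eq: "f + g = Fract (p * q' + p' * q) (q * q')"
    using f g by simp
  have "degree (p * q' + p' * q) \<le> max (degree p + degree q') (degree p' + degree q)"
    by (rule degree_add_le_max[THEN order_trans]) (intro max.mono degree_mult_le)
  moreover have "degree (q * q') = degree q + degree q'"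
    using f g by (simp add: degree_mult_eq)
  ultimately show ?thesis
    unfolding fdeg_le_def using f g eq
    by (intro exI[of _ "p * q' + p' * q"] exI[of _ "q * q'"]) auto
qed

lemma fdeg_le_mult:
  assumes "fdeg_le f m" "fdeg_le g m'"
  shows "fdeg_le (f * g) (m + m')"
proof -
  obtain p q where f: "q \<noteq> 0" "f = Fract p q" "int (degree p) \<le> int (degree q) + m"
    using assms(1) fdeg_le_def by blast
  obtain p' q' where g: "q' \<noteq> 0" "g = Fract p' q'" "int (degree p') \<le> int (degree q') + m'"
    using assms(2) fdeg_le_def by blast
  have "degree (p * p') \<le> degree p + degree p'" by (rule degree_mult_le)
  moreover have "degree (q * q') = degree q + degree q'"
    using f g by (simp add: degree_mult_eq)
  ultimately show ?thesis
    unfolding fdeg_le_def using f g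
    by (intro exI[of _ "p * p'"] exI[of _ "q * q'"]) auto
qed

lemma fdeg_le_0: "fdeg_le 0 m"
proof -
  have "(0::ratfun) = Fract 0 (monom 1 (nat (- m)))"
    by (simp add: fract_collapse)
  then show ?thesis
    unfolding fdeg_le_def
    by (intro exI[of _ 0] exI[of _ "monom 1 (nat (- m))"]) (auto simp: degree_monom_eq monom_eq_0_iff)
qed

lemma fdeg_le_const: "fdeg_le (const_ratfun r) 0"
  unfolding fdeg_le_def to_fract_def by (intro exI[of _ "[:r:]"] exI[of _ 1]) auto

lemma fdeg_le_const_mult: "fdeg_le f m \<Longrightarrow> fdeg_le (const_ratfun r * f) m"
  using fdeg_le_mult[OF fdeg_le_const, of f m r] by simp

lemma fdeg_le_mult_const: "fdeg_le f m \<Longrightarrow> fdeg_le (f * const_ratfun r) m"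
  using fdeg_le_const_mult by (simp add: mult.commute)

lemma fdeg_le_sum: "(\<And>i. i \<in> I \<Longrightarrow> fdeg_le (f i) m) \<Longrightarrow> fdeg_le (\<Sum>i\<in>I. f i) m"
  by (induction I rule: infinite_finite_induct) (auto intro: fdeg_le_add fdeg_le_0)

lemma fdeg_le_diff:
  assumes "fdeg_le f m" "fdeg_le g m"
  shows "fdeg_le (f - g) m"
proof -
  have "const_ratfun (-1) = - 1"
    by (metis one_pCons minus_pCons minus_zero to_fract_1 to_fract_uminus)
  then show ?thesis
    using fdeg_le_add[OF assms(1) fdeg_le_const_mult[OF assms(2), of "-1"]] by simp
qed

lemma fdeg_le_z_mult_cancel:
  assumes "fdeg_le (z_var * f) m"
  shows "fdeg_le f (m - 1)"
proof -
  obtain p q where f: "q \<noteq> 0" "z_var * f = Fract p q" "int (degree p) \<le> int (degree q) + m"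
    using assms(1) fdeg_le_def by blast
  have "f = Fract p ([:0,1:] * q)"
  proof -
    have z0: "z_var \<noteq> 0" by simp
    have "f = (z_var * f) / z_var" using z0 by simp
    also have "\<dots> = Fract p ([:0,1:] * q)"
      unfolding f(2) Fract_conv_to_fract to_fract_mult by (simp add: divide_simps)
    finally show ?thesis .
  qed
  moreover have "degree ([:0,1:] * q) = Suc (degree q)"
    using f(1) by (simp add: degree_mult_eq)
  ultimately show ?thesis
    unfolding fdeg_le_def using f
    by (intro exI[of _ p] exI[of _ "[:0,1:] * q"]) auto
qed

text \<open>In every fraction equal to a nonzero constant, numerator and denominator have the same
  degree. This is what lets a coefficient at infinity be read off.\<close>

lemma const_ratfun_fdeg_neg:
  assumes "fdeg_le (const_ratfun r) (-1)"
  shows "r = 0"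
proof (rule ccontr)
  assume r: "r \<noteq> 0"
  obtain p q where f: "q \<noteq> 0" "const_ratfun r = Fract p q" "int (degree p) \<le> int (degree q) - 1"
    using assms fdeg_le_def by auto
  have "[:r:] * q = p"
    using f(1,2) by (simp add: to_fract_def eq_fract)
  then have "degree p = degree q" using r by auto
  then show False using f(3) by simp
qed

lemma proper_iff_fdeg_le: "proper f \<longleftrightarrow> fdeg_le f 0"
  unfolding proper_def fdeg_le_def by (simp add: conj_commute conj_left_commute)

section \<open>Matrices over the rational functions, and the resolvent\<close>

lemma const_mat_mult:
  assumes "X \<in> carrier_mat a b" "Y \<in> carrier_mat b c"
  shows "const_mat (X * Y) = const_mat X * const_mat Y"
proof -
  interpret comm_ring_hom const_ratfun
    by unfold_locales (simp_all flip: to_fract_add to_fract_mult one_pCons)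
  show ?thesis by (rule mat_hom_mult[OF assms])
qed

lemma det_map_to_fract: "det (map_mat to_fract M) = to_fract (det (M :: real poly mat))"
proof -
  interpret comm_ring_hom "to_fract :: real poly \<Rightarrow> ratfun"
    by unfold_locales simp_all
  show ?thesis by (rule hom_det)
qed

lemma mat_inverse_right_inverse:
  fixes M :: "'a::field mat"
  assumes "M \<in> carrier_mat n n" "det M \<noteq> 0"
  shows "mat_inv M \<in> carrier_mat n n" "M * mat_inv M = 1\<^sub>m n"
proof -
  have "M \<in> Units (ring_mat TYPE('a) n ())"
    by (rule det_non_zero_imp_unit[OF assms])
  then obtain N where "mat_inverse M = Some N"
    using mat_inverse(1)[OF assms(1), where b = "()"] by blast
  then show "mat_inv M \<in> carrier_mat n n" "M * mat_inv M = 1\<^sub>m n"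
    using mat_inverse(2)[OF assms(1)] by auto
qed

abbreviation resolvent :: "real mat \<Rightarrow> ratfun mat" where
  "resolvent A \<equiv> mat_inv (z_var \<cdot>\<^sub>m 1\<^sub>m (dim_row A) - const_mat A)"

text \<open>The determinant of \<open>zI - A\<close> is the characteristic polynomial of
  \<open>A\<close>, monic and hence nonzero, so the inverse exists. The equation stands in for the
  Neumann series: each use peels off one power of \<open>1/z\<close>.\<close>

lemma
  assumes A: "A \<in> carrier_mat r r"
  shows resolvent_carrier: "resolvent A \<in> carrier_mat r r"
    and resolvent_eq: "z_var \<cdot>\<^sub>m resolvent A = 1\<^sub>m r + const_mat A * resolvent A"
proof -
  let ?M = "z_var \<cdot>\<^sub>m 1\<^sub>m (dim_row A) - const_mat A"
  have M: "?M \<in> carrier_mat r r" using A by auto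
  have "?M = map_mat to_fract (char_poly_matrix A)"
    using A by (intro eq_matI) (auto simp: char_poly_matrix_def simp flip: to_fract_uminus to_fract_diff)
  then have "det ?M = to_fract (char_poly A)"
    by (simp add: char_poly_def det_map_to_fract)
  moreover have "char_poly A \<noteq> 0"
    using degree_monic_char_poly[OF A] by auto
  ultimately have d: "det ?M \<noteq> 0" by simp
  show W: "resolvent A \<in> carrier_mat r r"
    by (rule mat_inverse_right_inverse[OF M d])
  have "1\<^sub>m r = ?M * resolvent A"
    using mat_inverse_right_inverse(2)[OF M d] by simp
  also have "\<dots> = z_var \<cdot>\<^sub>m 1\<^sub>m (dim_row A) * resolvent A - const_mat A * resolvent A"
    using A W by (intro minus_mult_distrib_mat[of _ r r]) auto
  also have "z_var \<cdot>\<^sub>m 1\<^sub>m (dim_row A) * resolvent A = z_var \<cdot>\<^sub>m resolvent A"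
    using A W by (simp add: mult_smult_assoc_mat[of _ r r _ r])
  finally have "1\<^sub>m r = z_var \<cdot>\<^sub>m resolvent A - const_mat A * resolvent A" .
  moreover have "z_var \<cdot>\<^sub>m resolvent A =
      z_var \<cdot>\<^sub>m resolvent A - const_mat A * resolvent A + const_mat A * resolvent A"
    using A W by (intro eq_matI) auto
  ultimately show "z_var \<cdot>\<^sub>m resolvent A = 1\<^sub>m r + const_mat A * resolvent A"
    by simp
qed

text \<open>A descent instead of a computation with cofactors: the finitely many entries have some
  common degree bound, and it is lowered to -1, where the constant entries of the identity matrix
  stop it.\<close>

lemma resolvent_strictly_proper:
  assumes A: "A \<in> carrier_mat r r" and "i < r" "j < r"
  shows "fdeg_le (resolvent A $$ (i, j)) (-1)"
proof -
  let ?W = "resolvent A"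
  note W = resolvent_carrier[OF A]
  have entry: "z_var * ?W $$ (i, j) =
      (if i = j then 1 else 0) + (\<Sum>l<r. const_ratfun (A $$ (i, l)) * ?W $$ (l, j))"
    if "i < r" "j < r" for i j
    using arg_cong[OF resolvent_eq[OF A], of "\<lambda>M. M $$ (i, j)"] that A W
    by (simp add: scalar_prod_def atLeast0LessThan)
  have one: "fdeg_le (if i = j then 1 else 0) 0" for i j :: nat
    using fdeg_le_const[of 1] fdeg_le_0 by (simp add: one_pCons[symmetric])
  have "\<exists>m::nat. \<forall>i<r. \<forall>j<r. fdeg_le (?W $$ (i, j)) (int m)"
  proof -
    define m where "m i j = (SOME m. fdeg_le (?W $$ (i, j)) (int m))" for i j
    have m: "fdeg_le (?W $$ (i, j)) (int (m i j))" for i j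
      unfolding m_def by (rule someI_ex[OF fdeg_le_exists])
    let ?B = "Max ((\<lambda>(i, j). m i j) ` ({..<r} \<times> {..<r}))"
    have "m i j \<le> ?B" if "i < r" "j < r" for i j
    proof (rule Max_ge)
      show "m i j \<in> (\<lambda>(i, j). m i j) ` ({..<r} \<times> {..<r})"
        by (rule image_eqI[of _ _ "(i, j)"]) (simp_all add: that)
    qed simp
    then have "fdeg_le (?W $$ (i, j)) (int ?B)" if "i < r" "j < r" for i j
      using that by (intro fdeg_le_mono[OF m]) simp
    then show ?thesis by blast
  qed
  then obtain m :: nat where m: "\<forall>i<r. \<forall>j<r. fdeg_le (?W $$ (i, j)) (int m)"
    by blast
  \<comment> \<open>In \<open>zW = 1 + AW\<close> a degree bound \<open>m \<ge> 0\<close> for \<open>W\<close> bounds \<open>zW\<close>, so it can be lowered by one.\<close>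
  have step: "\<forall>i<r. \<forall>j<r. fdeg_le (?W $$ (i, j)) (int m - 1)"
    if m: "\<forall>i<r. \<forall>j<r. fdeg_le (?W $$ (i, j)) (int m)" for m
  proof (intro allI impI)
    fix i j assume ij: "i < r" "j < r"
    have "fdeg_le (\<Sum>l<r. const_ratfun (A $$ (i, l)) * ?W $$ (l, j)) (int m)"
      by (rule fdeg_le_sum, rule fdeg_le_const_mult) (simp add: m ij)
    then have "fdeg_le (z_var * ?W $$ (i, j)) (int m)"
      unfolding entry[OF ij] by (rule fdeg_le_add[OF fdeg_le_mono[OF one of_nat_0_le_iff]])
    then show "fdeg_le (?W $$ (i, j)) (int m - 1)"
      by (rule fdeg_le_z_mult_cancel)
  qed
  have "\<forall>i<r. \<forall>j<r. fdeg_le (?W $$ (i, j)) (-1)"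
    using m
  proof (induction m)
    case 0
    from step[OF this] show ?case by simp
  next
    case (Suc m)
    from step[OF Suc.prems] have "\<forall>i<r. \<forall>j<r. fdeg_le (?W $$ (i, j)) (int m)" by simp
    then show ?case by (rule Suc.IH)
  qed
  then show ?thesis using assms by blast
qed

text \<open>The coefficients of the expansion of \<open>f\<close> in powers of \<open>1/z\<close>.\<close>

definition has_markov :: "ratfun \<Rightarrow> (nat \<Rightarrow> real) \<Rightarrow> bool" where
  "has_markov f h \<longleftrightarrow>
     (\<forall>k. fdeg_le (z_var ^ k * f - (\<Sum>l\<le>k. const_ratfun (h l) * z_var ^ (k - l))) (-1))"

text \<open>Meaningful only where an expansion exists; for entries of transfer matrices
  \<open>has_markov_transfer_matrix\<close> supplies one.\<close>

definition markov :: "ratfun \<Rightarrow> nat \<Rightarrow> real" where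
  "markov f = (SOME h. has_markov f h)"

text \<open>Once the coefficients below \<open>k\<close> agree, subtracting the two conditions at
  \<open>k\<close> leaves the constant \<open>h k - h' k\<close>, which has negative degree only if
  it is 0.\<close>

lemma has_markov_unique:
  assumes "has_markov f h" "has_markov f h'"
  shows "h = h'"
proof
  fix k
  show "h k = h' k"
  proof (induction k rule: less_induct)
    case (less k)
    let ?s = "\<lambda>h. \<Sum>l\<le>k. const_ratfun (h l) * z_var ^ (k - l)"
    have s: "?s h = (\<Sum>l<k. const_ratfun (h l) * z_var ^ (k - l)) + const_ratfun (h k)" for h
      by (simp flip: lessThan_Suc_atMost)
    have "fdeg_le ((z_var ^ k * f - ?s h') - (z_var ^ k * f - ?s h)) (-1)"
      using assms unfolding has_markov_def by (blast intro: fdeg_le_diff)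
    also have "(z_var ^ k * f - ?s h') - (z_var ^ k * f - ?s h) = const_ratfun (h k - h' k)"
      using less unfolding s by (simp flip: to_fract_diff)
    finally show ?case
      using const_ratfun_fdeg_neg[of "h k - h' k"] by simp
  qed
qed

lemma markov_eqI: "has_markov f h \<Longrightarrow> markov f = h"
  unfolding markov_def using has_markov_unique someI by metis

lemma transfer_matrix_carrier:
  assumes "AK \<in> carrier_mat r r" "BK \<in> carrier_mat r n" "CK \<in> carrier_mat n r" "DK \<in> carrier_mat n n"
  shows "transfer_matrix AK BK CK DK \<in> carrier_mat n n"
  using assms resolvent_carrier[OF assms(1)] unfolding transfer_matrix_def by auto

lemma horner_sum_Suc:
  fixes z :: "'a::comm_ring_1"
  shows "(\<Sum>l\<le>Suc k. g l * z ^ (Suc k - l)) = z * (\<Sum>l\<le>k. g l * z ^ (k - l)) + g (Suc k)"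
proof -
  have "(\<Sum>l\<le>k. g l * z ^ (Suc k - l)) = (\<Sum>l\<le>k. z * (g l * z ^ (k - l)))"
    by (rule sum.cong) (simp_all add: Suc_diff_le mult.left_commute)
  then show ?thesis by (simp add: sum_distrib_left)
qed

text \<open>The strictly proper remainder of \<open>z^k f\<close> is exactly the entry of
  \<open>T k = C A^k (zI - A)^-1 B\<close>. The resolvent equation gives
  \<open>z T(k) = C A^k B + T(k+1)\<close> and so releases one coefficient per step.\<close>

lemma has_markov_transfer_matrix:
  assumes c: "AK \<in> carrier_mat r r" "BK \<in> carrier_mat r n" "CK \<in> carrier_mat n r" "DK \<in> carrier_mat n n"
    and ij: "i < n" "j < n"
  shows "has_markov (transfer_matrix AK BK CK DK $$ (i, j))
    (\<lambda>k. case k of 0 \<Rightarrow> DK $$ (i, j) | Suc l \<Rightarrow> (CK * (AK ^\<^sub>m l) * BK) $$ (i, j))"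
    (is "has_markov ?f ?h")
proof -
  let ?W = "resolvent AK"
  define h where "h = ?h"
  define f where "f = ?f"
  have h0: "h 0 = DK $$ (i, j)" and hS: "h (Suc k) = (CK * (AK ^\<^sub>m k) * BK) $$ (i, j)" for k
    unfolding h_def by simp_all
  note W = resolvent_carrier[OF c(1)]
  define T where "T k = const_mat (CK * (AK ^\<^sub>m k)) * ?W * const_mat BK" for k
  note [simp] = pow_carrier_mat[OF c(1)]
  have Ck: "CK * (AK ^\<^sub>m k) \<in> carrier_mat n r" for k using c by (intro mult_carrier_mat) auto
  have T: "T k \<in> carrier_mat n n" for k unfolding T_def using c W Ck[of k] by auto
  have Tij: "T k $$ (i, j) =
      (\<Sum>l<r. (\<Sum>l'<r. const_ratfun ((CK * (AK ^\<^sub>m k)) $$ (i, l')) * ?W $$ (l', l)) * const_ratfun (BK $$ (l, j)))" for k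
    unfolding T_def using c W Ck[of k] ij by (simp add: scalar_prod_def atLeast0LessThan)
  have deg: "fdeg_le (T k $$ (i, j)) (-1)" for k
    unfolding Tij
    by (intro fdeg_le_sum fdeg_le_mult_const fdeg_le_const_mult resolvent_strictly_proper[OF c(1)]) auto
  have step: "z_var * T k $$ (i, j) = const_ratfun (h (Suc k)) + T (Suc k) $$ (i, j)" for k
  proof -
    let ?C = "CK * (AK ^\<^sub>m k)"
    note cc = Ck[of k] c W
    have "z_var \<cdot>\<^sub>m T k = const_mat ?C * (z_var \<cdot>\<^sub>m ?W) * const_mat BK"
      unfolding T_def using cc
      by (subst mult_smult_distrib[of _ n r _ r], (auto)[2], subst mult_smult_assoc_mat[of _ n r _ n]) auto
    also have "\<dots> = const_mat ?C * (1\<^sub>m r + const_mat AK * ?W) * const_mat BK"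
      unfolding resolvent_eq[OF c(1)] ..
    also have "\<dots> = (const_mat ?C + const_mat ?C * (const_mat AK * ?W)) * const_mat BK"
      using cc by (subst mult_add_distrib_mat[of _ n r _ r]) auto
    also have "\<dots> = const_mat ?C * const_mat BK + const_mat ?C * (const_mat AK * ?W) * const_mat BK"
      using cc by (subst add_mult_distrib_mat[of _ n r]) auto
    also have "const_mat ?C * (const_mat AK * ?W) = const_mat ?C * const_mat AK * ?W"
      using cc by (subst assoc_mult_mat[of _ n r _ r _ r]) auto
    also have "const_mat ?C * const_mat AK = const_mat (?C * AK)"
      using cc by (simp add: const_mat_mult[of _ n r _ r])
    also have "?C * AK = CK * (AK ^\<^sub>m Suc k)"
      using cc by (simp add: assoc_mult_mat[of _ n r _ r _ r])
    also have "const_mat ?C * const_mat BK = const_mat (?C * BK)"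
      using cc by (simp add: const_mat_mult[of _ n r _ n])
    finally have "z_var \<cdot>\<^sub>m T k = const_mat (?C * BK) + T (Suc k)"
      unfolding T_def .
    from arg_cong[OF this, of "\<lambda>M. M $$ (i, j)"] show ?thesis
      using ij T[of k] T[of "Suc k"] cc by (simp add: hS)
  qed
  have main: "z_var ^ k * f - (\<Sum>l\<le>k. const_ratfun (h l) * z_var ^ (k - l)) = T k $$ (i, j)" for k
  proof (induction k)
    case 0
    have "f = T 0 $$ (i, j) + const_ratfun (DK $$ (i, j))"
      using c ij T[of 0] W by (simp add: transfer_matrix_def T_def f_def)
    then show ?case by (simp add: h0)
  next
    case (Suc k)
    have s: "(\<Sum>l\<le>Suc k. const_ratfun (h l) * z_var ^ (Suc k - l)) =
      z_var * (\<Sum>l\<le>k. const_ratfun (h l) * z_var ^ (k - l)) + const_ratfun (h (Suc k))"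
      by (rule horner_sum_Suc)
    have "z_var ^ Suc k * f - (\<Sum>l\<le>Suc k. const_ratfun (h l) * z_var ^ (Suc k - l)) =
        z_var * (z_var ^ k * f - (\<Sum>l\<le>k. const_ratfun (h l) * z_var ^ (k - l))) - const_ratfun (h (Suc k))"
      unfolding s by (simp add: algebra_simps)
    also have "\<dots> = T (Suc k) $$ (i, j)"
      unfolding Suc step by simp
    finally show ?case .
  qed
  have "has_markov f h"
    unfolding has_markov_def main by (intro allI deg)
  then show ?thesis
    unfolding f_def h_def .
qed

lemma transfer_matrix_proper:
  assumes c: "AK \<in> carrier_mat r r" "BK \<in> carrier_mat r n" "CK \<in> carrier_mat n r" "DK \<in> carrier_mat n n"
    and ij: "i < n" "j < n"
  shows "proper (transfer_matrix AK BK CK DK $$ (i, j))"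
proof -
  let ?f = "transfer_matrix AK BK CK DK $$ (i, j)"
  have "fdeg_le (?f - const_ratfun (DK $$ (i, j))) (-1)"
    using has_markov_transfer_matrix[OF assms, unfolded has_markov_def, THEN spec, of 0] by simp
  from fdeg_le_add[OF fdeg_le_mono[OF this, of 0] fdeg_le_const[of "DK $$ (i, j)"]]
  show ?thesis unfolding proper_iff_fdeg_le by simp
qed

section \<open>Closed-loop signals and cost\<close>

text \<open>The controller starts at rest, so no term for its initial state appears; hence the
  signals do not depend on the realization.\<close>

definition markov_output :: "nat \<Rightarrow> ratfun mat \<Rightarrow> (nat \<Rightarrow> nat \<Rightarrow> real) \<Rightarrow> nat \<Rightarrow> nat \<Rightarrow> real" where
  "markov_output n K x k i = (\<Sum>l\<le>k. \<Sum>j<n. markov (K $$ (i, j)) (k - l) * x l j)"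

lemma index_mult_mat_vec_sum:
  "M \<in> carrier_mat m n \<Longrightarrow> v \<in> carrier_vec n \<Longrightarrow> i < m \<Longrightarrow> (M *\<^sub>v v) $ i = (\<Sum>j<n. M $$ (i, j) * v $ j)"
  by (simp add: scalar_prod_def atLeast0LessThan)

lemma state_space_output:
  assumes re: "realizes n K AK BK CK DK"
    and x: "\<And>k. x k \<in> carrier_vec n"
    and xK0: "xK 0 = 0\<^sub>v (dim_row AK)"
    and xKS: "\<And>k. xK (Suc k) = AK *\<^sub>v xK k + BK *\<^sub>v x k"
    and i: "i < n"
  shows "(CK *\<^sub>v xK k + DK *\<^sub>v x k) $ i = markov_output n K (\<lambda>k i. x k $ i) k i"
proof -
  obtain r where c: "AK \<in> carrier_mat r r" "BK \<in> carrier_mat r n" "CK \<in> carrier_mat n r" "DK \<in> carrier_mat n n"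
    and K: "K = transfer_matrix AK BK CK DK"
    using re unfolding realizes_def by blast
  have xK: "xK k \<in> carrier_vec r" for k
    by (induction k) (use c x xK0 xKS in \<open>auto intro!: add_carrier_vec\<close>)
  define M where "M m = CK * (AK ^\<^sub>m m)" for m
  have M: "M m \<in> carrier_mat n r" for m
    unfolding M_def using c by (auto intro: mult_carrier_mat pow_carrier_mat)
  have MS: "M m * AK = M (Suc m)" for m
    unfolding M_def using c by (simp add: assoc_mult_mat[of _ n r _ r _ r] pow_carrier_mat)
  \<comment> \<open>Generalized over \<open>m\<close>: the step turns \<open>C A^m x_K(k+1)\<close>
    into \<open>C A^(m+1) x_K(k)\<close>, so the case \<open>m = 0\<close> alone would not be
    inductive.\<close>
  have main: "(M m *\<^sub>v xK k) $ i = (\<Sum>l<k. \<Sum>j<n. (M (m + (k - Suc l)) * BK) $$ (i, j) * x l $ j)" for m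
  proof (induction k arbitrary: m)
    case 0
    have "M m *\<^sub>v xK 0 = 0\<^sub>v n"
      using M[of m] c xK0 by auto
    then show ?case using i by simp
  next
    case (Suc k)
    have "M m *\<^sub>v xK (Suc k) = M m *\<^sub>v (AK *\<^sub>v xK k) + M m *\<^sub>v (BK *\<^sub>v x k)"
      unfolding xKS using M c xK x by (intro mult_add_distrib_mat_vec[of _ n r]) auto
    also have "M m *\<^sub>v (AK *\<^sub>v xK k) = M (Suc m) *\<^sub>v xK k"
      unfolding MS[symmetric] using M c xK by (intro assoc_mult_mat_vec[symmetric]) auto
    also have "M m *\<^sub>v (BK *\<^sub>v x k) = (M m * BK) *\<^sub>v x k"
      using M c x by (intro assoc_mult_mat_vec[symmetric]) auto
    finally have "(M m *\<^sub>v xK (Suc k)) $ i = (M (Suc m) *\<^sub>v xK k) $ i + ((M m * BK) *\<^sub>v x k) $ i"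
      using i M[of m] M[of "Suc m"] c x xK by simp
    also have "((M m * BK) *\<^sub>v x k) $ i = (\<Sum>j<n. (M m * BK) $$ (i, j) * x k $ j)"
      using i M[of m] c x by (intro index_mult_mat_vec_sum[of _ n]) auto
    also have "(M (Suc m) *\<^sub>v xK k) $ i = (\<Sum>l<k. \<Sum>j<n. (M (m + (Suc k - Suc l)) * BK) $$ (i, j) * x l $ j)"
      unfolding Suc.IH
    proof (rule sum.cong)
      fix l assume "l \<in> {..<k}"
      then have "Suc m + (k - Suc l) = m + (Suc k - Suc l)" by auto
      then show "(\<Sum>j<n. (M (Suc m + (k - Suc l)) * BK) $$ (i, j) * x l $ j) =
        (\<Sum>j<n. (M (m + (Suc k - Suc l)) * BK) $$ (i, j) * x l $ j)" by (simp only:)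
    qed simp
    finally show ?case by simp
  qed
  have mk: "markov (K $$ (i, j)) = (\<lambda>k. case k of 0 \<Rightarrow> DK $$ (i, j) | Suc l \<Rightarrow> (M l * BK) $$ (i, j))"
    if "j < n" for j
    unfolding K M_def by (intro markov_eqI has_markov_transfer_matrix[OF c i that])
  have "(CK *\<^sub>v xK k + DK *\<^sub>v x k) $ i = (M 0 *\<^sub>v xK k) $ i + (DK *\<^sub>v x k) $ i"
    unfolding M_def using c i x by simp
  also have "(DK *\<^sub>v x k) $ i = (\<Sum>j<n. DK $$ (i, j) * x k $ j)"
    using c i x by (intro index_mult_mat_vec_sum)
  also have "\<dots> = (\<Sum>j<n. markov (K $$ (i, j)) (k - k) * x k $ j)"
    by (intro sum.cong) (simp_all add: mk)
  also have "(M 0 *\<^sub>v xK k) $ i = (\<Sum>l<k. \<Sum>j<n. markov (K $$ (i, j)) (k - l) * x l $ j)"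
    unfolding main
  proof (intro sum.cong refl)
    fix l j assume "l \<in> {..<k}" "j \<in> {..<n}"
    then have "k - l = Suc (k - Suc l)" "j < n" by auto
    then show "(M (0 + (k - Suc l)) * BK) $$ (i, j) * x l $ j = markov (K $$ (i, j)) (k - l) * x l $ j"
      by (simp add: mk)
  qed
  finally show ?thesis
    unfolding markov_output_def by (simp flip: lessThan_Suc_atMost)
qed

text \<open>Here \<open>v = u + w\<close> is the total input, and \<open>w(k) = D\<^sup>k w\<^sub>0\<close> is used componentwise.\<close>

definition loop_signals ::
  "nat \<Rightarrow> plant \<Rightarrow> ratfun mat \<Rightarrow> (nat \<Rightarrow> nat \<Rightarrow> real) \<Rightarrow> (nat \<Rightarrow> nat \<Rightarrow> real) \<Rightarrow> bool" where
  "loop_signals n P K x v \<longleftrightarrow> (case P of (A, B, D, x0, w0) \<Rightarrow>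
     (\<forall>i<n. x 0 i = x0 $ i) \<and>
     (\<forall>k. \<forall>i<n. x (Suc k) i = (\<Sum>j<n. A $$ (i, j) * x k j) + B $$ (i, i) * v k i \<and>
        v k i = markov_output n K x k i + D $$ (i, i) ^ k * w0 $ i))"

lemma markov_output_cong:
  "(\<And>l j. l \<le> k \<Longrightarrow> j < n \<Longrightarrow> x l j = x' l j) \<Longrightarrow> markov_output n K x k i = markov_output n K x' k i"
  unfolding markov_output_def by (auto intro!: sum.cong)

text \<open>Causality: \<open>v k\<close> reads \<open>x\<close> up to time \<open>k\<close>, and
  \<open>x (Suc k)\<close> reads time \<open>k\<close> only. This leaves the definite description in
  \<open>cost\<close> at most one value.\<close>

lemma loop_signals_unique:
  assumes "loop_signals n P K x v" "loop_signals n P K x' v'"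
  shows "i < n \<Longrightarrow> x k i = x' k i" "i < n \<Longrightarrow> v k i = v' k i"
proof -
  obtain A B D x0 w0 where P: "P = (A, B, D, x0, w0)" by (cases P)
  note l = assms[unfolded loop_signals_def P prod.case]
  have *: "(\<forall>l\<le>k. \<forall>i<n. x l i = x' l i) \<and> (\<forall>i<n. v k i = v' k i)" for k
  proof (induction k)
    case 0
    then show ?case using l markov_output_cong[of 0 n x x'] by auto
  next
    case (Suc k)
    have "\<forall>i<n. x (Suc k) i = x' (Suc k) i"
      using l Suc by simp
    then have xs: "\<forall>l\<le>Suc k. \<forall>i<n. x l i = x' l i"
      using Suc by (simp add: le_Suc_eq)
    moreover have "\<forall>i<n. v (Suc k) i = v' (Suc k) i"
    proof (intro allI impI)
      fix i assume "i < n"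
      have "markov_output n K x (Suc k) i = markov_output n K x' (Suc k) i"
        using xs by (intro markov_output_cong) auto
      then show "v (Suc k) i = v' (Suc k) i" using l \<open>i < n\<close> by metis
    qed
    ultimately show ?case by blast
  qed
  show "i < n \<Longrightarrow> x k i = x' k i" "i < n \<Longrightarrow> v k i = v' k i"
    using * by blast+
qed

lemma closed_loop_imp_loop_signals:
  assumes c: "A \<in> carrier_mat n n" "B \<in> carrier_mat n n" "diagonal_mat B" "D \<in> carrier_mat n n" "diagonal_mat D"
    "x0 \<in> carrier_vec n" "w0 \<in> carrier_vec n"
    and re: "realizes n K AK BK CK DK"
    and cl: "closed_loop (A, B, D, x0, w0) AK BK CK DK x w xK u"
  shows "x k \<in> carrier_vec n" "u k \<in> carrier_vec n" "w k \<in> carrier_vec n"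
    and "loop_signals n (A, B, D, x0, w0) K (\<lambda>k i. x k $ i) (\<lambda>k i. (u k + w k) $ i)"
proof -
  obtain r where cK: "AK \<in> carrier_mat r r" "BK \<in> carrier_mat r n" "CK \<in> carrier_mat n r" "DK \<in> carrier_mat n n"
    and K: "K = transfer_matrix AK BK CK DK"
    using re unfolding realizes_def by blast
  note l = cl[unfolded closed_loop_def prod.case]
  have dg: "(M *\<^sub>v y) $ i = M $$ (i, i) * y $ i"
    if "M \<in> carrier_mat n n" "diagonal_mat M" "y \<in> carrier_vec n" "i < n" for M :: "real mat" and y i
  proof -
    have "(M *\<^sub>v y) $ i = (\<Sum>j<n. M $$ (i, j) * y $ j)"
      using that by (intro index_mult_mat_vec_sum)
    also have "\<dots> = (\<Sum>j\<in>{i}. M $$ (i, j) * y $ j)"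
      using that by (intro sum.mono_neutral_right) (auto simp: diagonal_mat_def)
    finally show ?thesis by simp
  qed
  \<comment> \<open>The dimension of a sum is that of its second summand, here fixed by the rows of
    \<open>DK\<close>. It is thus known before that of \<open>x k\<close>, which avoids a
    circle.\<close>
  have u_dim: "dim_vec (u k) = n" for k
    using l cK by (metis carrier_matD(1) dim_mult_mat_vec index_add_vec(2))
  then show u: "u k \<in> carrier_vec n" for k by (intro carrier_vecI)
  show w: "w k \<in> carrier_vec n" for k
    by (induction k) (use l c in auto)
  show x: "x k \<in> carrier_vec n" for k
    by (induction k) (use l c u w in \<open>auto intro!: add_carrier_vec\<close>)
  have wk: "w k $ i = D $$ (i, i) ^ k * w0 $ i" if "i < n" for k i
    by (induction k) (use l c that w in \<open>auto simp: dg simp del: index_mult_mat_vec\<close>)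
  have out: "u k $ i = markov_output n K (\<lambda>k i. x k $ i) k i" if "i < n" for k i
  proof -
    have "u k = CK *\<^sub>v xK k + DK *\<^sub>v x k" using l by blast
    then show ?thesis
      using state_space_output[OF re, where x = x and xK = xK and i = i and k = k] x l that by simp
  qed
  have xS: "x (Suc k) $ i = (\<Sum>j<n. A $$ (i, j) * x k $ j) + B $$ (i, i) * (u k + w k) $ i"
    if "i < n" for k i
  proof -
    have "x (Suc k) = A *\<^sub>v x k + B *\<^sub>v (u k + w k)" using l by blast
    moreover have "(A *\<^sub>v x k) $ i = (\<Sum>j<n. A $$ (i, j) * x k $ j)"
      using c x that by (intro index_mult_mat_vec_sum)
    moreover have "(B *\<^sub>v (u k + w k)) $ i = B $$ (i, i) * (u k + w k) $ i"
      using c u w that by (intro dg) auto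
    ultimately show ?thesis
      using that c by (simp del: index_mult_mat_vec)
  qed
  show "loop_signals n (A, B, D, x0, w0) K (\<lambda>k i. x k $ i) (\<lambda>k i. (u k + w k) $ i)"
    unfolding loop_signals_def prod.case
  proof (intro conjI allI impI)
    fix k i assume i: "i < n"
    show "x (Suc k) $ i = (\<Sum>j<n. A $$ (i, j) * x k $ j) + B $$ (i, i) * (u k + w k) $ i"
      by (rule xS[OF i])
    have "dim_vec (w k) = n" using w[of k] by simp
    then show "(u k + w k) $ i = markov_output n K (\<lambda>k i. x k $ i) k i + D $$ (i, i) ^ k * w0 $ i"
      using i by (simp add: wk out)
  qed (use l in auto)
qed

lemma closed_loop_exists: "\<exists>x w xK u. closed_loop P AK BK CK DK x w xK u"
proof -
  obtain A B D x0 w0 where P: "P = (A, B, D, x0, w0)" by (cases P)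
  define s where "s = rec_nat (x0, w0, 0\<^sub>v (dim_row AK)) (\<lambda>_ (x, w, xK).
    (A *\<^sub>v x + B *\<^sub>v ((CK *\<^sub>v xK + DK *\<^sub>v x) + w), D *\<^sub>v w, AK *\<^sub>v xK + BK *\<^sub>v x))"
  have s0: "s 0 = (x0, w0, 0\<^sub>v (dim_row AK))"
    and sS: "s (Suc k) = (case s k of (x, w, xK) \<Rightarrow>
      (A *\<^sub>v x + B *\<^sub>v ((CK *\<^sub>v xK + DK *\<^sub>v x) + w), D *\<^sub>v w, AK *\<^sub>v xK + BK *\<^sub>v x))" for k
    unfolding s_def by simp_all
  show ?thesis
    unfolding closed_loop_def P prod.case
    by (intro exI[of _ "\<lambda>k. fst (s k)"] exI[of _ "\<lambda>k. fst (snd (s k))"] exI[of _ "\<lambda>k. snd (snd (s k))"]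
        exI[of _ "\<lambda>k. CK *\<^sub>v snd (snd (s k)) + DK *\<^sub>v fst (s k)"])
      (simp add: s0 sS split: prod.split)
qed

definition signal_cost :: "nat \<Rightarrow> (nat \<Rightarrow> nat \<Rightarrow> real) \<Rightarrow> (nat \<Rightarrow> nat \<Rightarrow> real) \<Rightarrow> ennreal" where
  "signal_cost n x v = (\<Sum>k. ennreal (\<Sum>i<n. (x k i)\<^sup>2 + (v k i)\<^sup>2))"

lemma cost_eq_signal_cost:
  assumes c: "A \<in> carrier_mat n n" "B \<in> carrier_mat n n" "diagonal_mat B" "D \<in> carrier_mat n n" "diagonal_mat D"
    "x0 \<in> carrier_vec n" "w0 \<in> carrier_vec n"
    and re: "realizes n K AK BK CK DK"
  obtains x v where "loop_signals n (A, B, D, x0, w0) K x v" "cost n (A, B, D, x0, w0) K = signal_cost n x v"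
proof -
  let ?P = "(A, B, D, x0, w0)"
  obtain x w xK u where cl: "closed_loop ?P AK BK CK DK x w xK u"
    using closed_loop_exists by blast
  define x' where "x' = (\<lambda>k i. x k $ i)"
  define v' where "v' = (\<lambda>k i. (u k + w k) $ i)"
  have lp: "loop_signals n ?P K x' v'"
    unfolding x'_def v'_def by (rule closed_loop_imp_loop_signals(4)[OF c re cl])
  \<comment> \<open>Shown for every realization and all of its signals; both halves of the definite
    description use it.\<close>
  have sc: "(\<Sum>k. ennreal (x k \<bullet> x k + (u k + w k) \<bullet> (u k + w k))) = signal_cost n x' v'"
    if re: "realizes n K AK BK CK DK" and cl: "closed_loop ?P AK BK CK DK x w xK u"
    for AK BK CK DK x w xK u
  proof -
    note l = closed_loop_imp_loop_signals[OF c re cl]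
    have "(\<Sum>i<n. (x' k i)\<^sup>2 + (v' k i)\<^sup>2) = x k \<bullet> x k + (u k + w k) \<bullet> (u k + w k)" for k
    proof -
      have d: "dim_vec (x k) = n" "dim_vec (u k + w k) = n"
        using l(1,3)[of k] by auto
      have "(\<Sum>i<n. (x' k i)\<^sup>2 + (v' k i)\<^sup>2) = (\<Sum>i<n. (x k $ i)\<^sup>2 + ((u k + w k) $ i)\<^sup>2)"
        using loop_signals_unique[OF lp l(4)] by (intro sum.cong) auto
      then show ?thesis
        unfolding scalar_prod_def d by (simp add: sum.distrib power2_eq_square atLeast0LessThan)
    qed
    then show ?thesis unfolding signal_cost_def by simp
  qed
  have "cost n ?P K = signal_cost n x' v'"
    unfolding cost_def
  proof (rule the_equality)
    show "\<exists>AK BK CK DK x w xK u. realizes n K AK BK CK DK \<and> closed_loop ?P AK BK CK DK x w xK u \<and>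
        signal_cost n x' v' = (\<Sum>k. ennreal (x k \<bullet> x k + (u k + w k) \<bullet> (u k + w k)))"
      using re cl sc[OF re cl] by (metis (no_types))
  next
    fix J
    assume "\<exists>AK BK CK DK x w xK u. realizes n K AK BK CK DK \<and> closed_loop ?P AK BK CK DK x w xK u \<and>
        J = (\<Sum>k. ennreal (x k \<bullet> x k + (u k + w k) \<bullet> (u k + w k)))"
    then show "J = signal_cost n x' v'" using sc by blast
  qed
  with lp that show thesis by blast
qed

section \<open>The deadbeat design method\<close>

lemma diagonal_mat_eq_mat_diag:
  "M \<in> carrier_mat n n \<Longrightarrow> diagonal_mat M \<Longrightarrow> M = mat_diag n (\<lambda>i. M $$ (i, i))"
  by (intro eq_matI) (auto simp: mat_diag_def diagonal_mat_def)

lemma mat_inv_mat_diag: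
  fixes g :: "nat \<Rightarrow> 'a::field"
  assumes g: "\<And>i. i < n \<Longrightarrow> g i \<noteq> 0"
  shows "mat_inv (mat_diag n g) = mat_diag n (\<lambda>i. inverse (g i))"
proof -
  let ?M = "mat_diag n g" and ?N = "mat_diag n (\<lambda>i. inverse (g i))"
  have "?M * ?N = 1\<^sub>m n" and NM: "?N * ?M = 1\<^sub>m n"
    unfolding mat_diag_diag using g by (auto intro!: eq_matI simp: mat_diag_def)
  then have "det ?M * det ?N = 1"
    by (metis det_mult det_one mat_diag_dim)
  then have "det ?M \<noteq> 0" by auto
  note I = mat_inverse_right_inverse[OF mat_diag_dim this]
  have "mat_inv ?M = ?N * ?M * mat_inv ?M" using NM I(1) by simp
  also have "\<dots> = ?N * (?M * mat_inv ?M)"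
    using I(1) by (intro assoc_mult_mat[of _ n n _ n _ n]) auto
  finally show ?thesis unfolding I(2) right_mult_one_mat[OF mat_diag_dim] .
qed

lemma singular_values_mat_diag: "singular_values (mat_diag n g) = (\<lambda>i. \<bar>g i\<bar>) ` {..<n}"
proof -
  let ?M = "mat_diag n (\<lambda>i. (g i)\<^sup>2)"
  have M: "transpose_mat (mat_diag n g) * mat_diag n g = ?M"
  proof -
    have "transpose_mat (mat_diag n g) = mat_diag n g"
      by (intro eq_matI) (auto simp: mat_diag_def)
    then show ?thesis by (simp add: power2_eq_square)
  qed
  have "upper_triangular ?M" by (auto simp: mat_diag_def)
  moreover have "diag_mat ?M = map (\<lambda>i. (g i)\<^sup>2) [0..<n]"
    by (auto simp: diag_mat_def mat_diag_def)
  ultimately have "char_poly ?M = (\<Prod>a\<leftarrow>map (\<lambda>i. (g i)\<^sup>2) [0..<n]. [:- a, 1:])"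
    using char_poly_upper_triangular[OF mat_diag_dim, of n] by metis
  then have "eigenvalue ?M t \<longleftrightarrow> (\<exists>i<n. t = (g i)\<^sup>2)" for t
    unfolding eigenvalue_root_char_poly[OF mat_diag_dim]
    by (auto simp: poly_prod_list prod_list_zero_iff)
  then show ?thesis
    unfolding singular_values_def M by (auto simp: image_iff) (metis real_sqrt_abs)
qed

lemma B_class_iff:
  assumes "0 < n"
  shows "B \<in> B_class n \<epsilon> \<longleftrightarrow> B \<in> carrier_mat n n \<and> diagonal_mat B \<and> (\<forall>i<n. \<epsilon> \<le> \<bar>B $$ (i, i)\<bar>)"
proof -
  have "\<epsilon> \<le> smallest_singular_value B \<longleftrightarrow> (\<forall>i<n. \<epsilon> \<le> \<bar>B $$ (i, i)\<bar>)"
    if "B \<in> carrier_mat n n" "diagonal_mat B"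
  proof -
    have "singular_values B = (\<lambda>i. \<bar>B $$ (i, i)\<bar>) ` {..<n}"
      by (subst diagonal_mat_eq_mat_diag[OF that]) (rule singular_values_mat_diag)
    then show ?thesis
      unfolding smallest_singular_value_def using assms by (subst Min_ge_iff) auto
  qed
  then show ?thesis unfolding B_class_def by auto
qed

text \<open>Serves the block diagonal realization of \<open>Gamma_Theta\<close>, where every
  subcontroller has a one-dimensional state.\<close>

lemma diag_block_mat_singletons:
  "diag_block_mat (map (\<lambda>a. mat 1 1 (\<lambda>_. a)) xs) = mat_diag (length xs) (\<lambda>i. xs ! i)"
proof (induction xs)
  case (Cons a xs)
  show ?case
    by (rule eq_matI)
      (auto simp: Cons Let_def mat_diag_def four_block_mat_def nth_Cons' simp flip: One_nat_def)
qed (auto simp: mat_diag_def)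

definition gain :: "nat \<Rightarrow> nat \<Rightarrow> real mat \<Rightarrow> real mat \<Rightarrow> nat \<Rightarrow> real" where
  "gain n c A B i = (if i < n - c then -1 else sink_gain A B i)"

text \<open>Written entrywise so that row \<open>i\<close> visibly uses only row \<open>i\<close> of
  \<open>A\<close> and the \<open>i\<close>-th diagonal entries of \<open>B\<close> and
  \<open>D\<close>, as a totally disconnected design graph demands.\<close>

definition Theta_input :: "nat \<Rightarrow> nat \<Rightarrow> real mat \<Rightarrow> real mat \<Rightarrow> real mat \<Rightarrow> real mat" where
  "Theta_input n c A B D = mat n n (\<lambda>(i, j).
     D $$ (i, i) / B $$ (i, i) *
       ((gain n c A B i + 1) * A $$ (i, j) - (if i = j then D $$ (i, i) else 0)))"

definition Theta_direct :: "nat \<Rightarrow> nat \<Rightarrow> real mat \<Rightarrow> real mat \<Rightarrow> real mat \<Rightarrow> real mat" where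
  "Theta_direct n c A B D = mat n n (\<lambda>(i, j).
     (gain n c A B i * A $$ (i, j) - (if i = j then D $$ (i, i) else 0)) / B $$ (i, i))"

context
  fixes n c :: nat and \<epsilon> :: real and A B D :: "real mat"
  assumes n: "0 < n" and \<epsilon>: "0 < \<epsilon>"
    and A: "A \<in> carrier_mat n n" and B: "B \<in> B_class n \<epsilon>" and D: "D \<in> D_class n"
begin

lemma B_diag_nonzero: "i < n \<Longrightarrow> B $$ (i, i) \<noteq> 0"
  using B \<epsilon> unfolding B_class_iff[OF n] by force

lemma Gamma_Theta_eq:
  "Gamma_Theta n c A B D = transfer_matrix D (Theta_input n c A B D) (1\<^sub>m n) (Theta_direct n c A B D)"
proof -
  have Bd: "B = mat_diag n (\<lambda>i. B $$ (i, i))"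
    using B unfolding B_class_iff[OF n] by (intro diagonal_mat_eq_mat_diag) auto
  have Dd: "D = mat_diag n (\<lambda>i. D $$ (i, i))"
    using D unfolding D_class_def by (intro diagonal_mat_eq_mat_diag) auto
  have iB: "mat_inv B = mat_diag n (\<lambda>i. inverse (B $$ (i, i)))"
    by (subst Bd) (rule mat_inv_mat_diag[OF B_diag_nonzero])
  have F: "F_mat n c A B = mat_diag n (gain n c A B)"
    unfolding F_mat_def gain_def ..
  have F1: "F_mat n c A B + 1\<^sub>m n = mat_diag n (\<lambda>i. gain n c A B i + 1)"
    unfolding F by (auto simp: mat_diag_def)
  have DD: "D * D = mat_diag n (\<lambda>i. D $$ (i, i) * D $$ (i, i))"
    by (subst (1 2) Dd) simp
  have BD: "mat_inv B * D = mat_diag n (\<lambda>i. inverse (B $$ (i, i)) * D $$ (i, i))"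
    unfolding iB by (subst Dd) simp
  have "mat_inv B * D * (F_mat n c A B + 1\<^sub>m n) * A - mat_inv B * (D * D) = Theta_input n c A B D"
    unfolding BD F1 DD unfolding iB mat_diag_diag mat_diag_mult_left[OF A]
    by (rule eq_matI) (auto simp: Theta_input_def mat_diag_def B_diag_nonzero field_simps)
  moreover have "F_mat n c A B * A - D = mat n n (\<lambda>(i, j).
     gain n c A B i * A $$ (i, j) - (if i = j then D $$ (i, i) else 0))"
    unfolding F mat_diag_mult_left[OF A]
    by (subst Dd, rule eq_matI) (auto simp: mat_diag_def)
  then have "mat_inv B * (F_mat n c A B * A - D) = Theta_direct n c A B D"
    unfolding iB by (subst mat_diag_mult_left[of _ n n]) (auto simp: Theta_direct_def field_simps)
  ultimately show ?thesis unfolding Gamma_Theta_def by simp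
qed

lemma Gamma_Theta_realizes:
  "realizes n (Gamma_Theta n c A B D) D (Theta_input n c A B D) (1\<^sub>m n) (Theta_direct n c A B D)"
  unfolding realizes_def Gamma_Theta_eq
  using D by (intro conjI exI[of _ n]) (auto simp: D_class_def Theta_input_def Theta_direct_def)

lemma Gamma_Theta_carrier: "Gamma_Theta n c A B D \<in> carrier_mat n n"
  unfolding Gamma_Theta_eq using D
  by (intro transfer_matrix_carrier) (auto simp: D_class_def Theta_input_def Theta_direct_def)

text \<open>With \<open>D\<close> its resolvent is diagonal too, so rows do not mix, and sparsity
  and locality can be read off entrywise.\<close>

lemma Gamma_Theta_index:
  assumes ij: "i < n" "j < n"
  shows "Gamma_Theta n c A B D $$ (i, j) =
    inverse (z_var - const_ratfun (D $$ (i, i))) * const_ratfun (Theta_input n c A B D $$ (i, j))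
      + const_ratfun (Theta_direct n c A B D $$ (i, j))"
proof -
  have Dc: "D \<in> carrier_mat n n" "diagonal_mat D"
    using D unfolding D_class_def by auto
  have "z_var \<cdot>\<^sub>m 1\<^sub>m (dim_row D) - const_mat D = mat_diag n (\<lambda>i. z_var - const_ratfun (D $$ (i, i)))"
    using Dc by (intro eq_matI) (auto simp: mat_diag_def diagonal_mat_def)
  moreover have "z_var - const_ratfun r \<noteq> 0" for r
    by (simp flip: to_fract_diff)
  ultimately have R: "resolvent D = mat_diag n (\<lambda>i. inverse (z_var - const_ratfun (D $$ (i, i))))"
    by (simp add: mat_inv_mat_diag)
  have c1: "const_mat (1\<^sub>m n) = 1\<^sub>m n"
    by (rule eq_matI) (auto simp flip: one_pCons)
  have c: "Theta_input n c A B D \<in> carrier_mat n n" "Theta_direct n c A B D \<in> carrier_mat n n"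
    unfolding Theta_input_def Theta_direct_def by auto
  have "const_mat (Theta_input n c A B D) \<in> carrier_mat n n" using c by auto
  note ml = mat_diag_mult_left[OF this]
  have "Gamma_Theta n c A B D = mat_diag n (\<lambda>i. inverse (z_var - const_ratfun (D $$ (i, i))))
      * const_mat (Theta_input n c A B D) + const_mat (Theta_direct n c A B D)"
    unfolding Gamma_Theta_eq transfer_matrix_def R c1 left_mult_one_mat[OF mat_diag_dim] ..
  then show ?thesis
    unfolding ml using c ij by simp
qed

end

lemma adjacency_mat_index: "i < n \<Longrightarrow> j < n \<Longrightarrow> adjacency_mat n E $$ (i, j) = (if (j, i) \<in> E then 1 else 0)"
  unfolding adjacency_mat_def by simp

lemma A_class_adjacency_iff:
  "A \<in> A_class n (adjacency_mat n E) \<longleftrightarrow>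
     A \<in> carrier_mat n n \<and> (\<forall>i<n. \<forall>j<n. (j, i) \<notin> E \<longrightarrow> A $$ (i, j) = 0)"
  unfolding A_class_def by (auto simp: adjacency_mat_index)

lemma Gamma_Theta_structured:
  assumes n: "0 < n" and \<epsilon>: "0 < \<epsilon>" and loops: "all_self_loops n EK"
    and EC: "totally_disconnected n EC" and sub: "EP \<subseteq> EK"
  shows "Gamma_Theta n c \<in> structured_design_methods n \<epsilon> EP EK EC"
proof -
  have "Gamma_Theta n c A B D \<in> controllers n (adjacency_mat n EK) \<and>
       (\<exists>A\<^sub>\<Gamma> B\<^sub>\<Gamma> C\<^sub>\<Gamma> D\<^sub>\<Gamma>. realizes n (Gamma_Theta n c A B D) A\<^sub>\<Gamma> B\<^sub>\<Gamma> C\<^sub>\<Gamma> D\<^sub>\<Gamma> \<and>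
          block_diagonal_realization n A\<^sub>\<Gamma> C\<^sub>\<Gamma>)"
    if A': "A \<in> A_class n (adjacency_mat n EP)" and B: "B \<in> B_class n \<epsilon>" and D: "D \<in> D_class n" for A B D
  proof
    have A: "A \<in> carrier_mat n n" and A0: "\<And>i j. i < n \<Longrightarrow> j < n \<Longrightarrow> (j, i) \<notin> EP \<Longrightarrow> A $$ (i, j) = 0"
      using A' unfolding A_class_adjacency_iff by auto
    have Dc: "D \<in> carrier_mat n n" "diagonal_mat D"
      using D unfolding D_class_def by auto
    have c: "Theta_input n c A B D \<in> carrier_mat n n" "Theta_direct n c A B D \<in> carrier_mat n n"
      unfolding Theta_input_def Theta_direct_def by auto
    have "Gamma_Theta n c A B D $$ (i, j) = 0"
      if ij: "i < n" "j < n" "adjacency_mat n EK $$ (i, j) = 0" for i j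
    proof -
      have "(j, i) \<notin> EK" using ij by (simp add: adjacency_mat_index split: if_splits)
      \<comment> \<open>Off the diagonal the entries vanish with those of \<open>A\<close>; the
        terms in \<open>D\<close> sit on the diagonal, where the self-loops of \<open>EK\<close>
        permit them.\<close>
      then have "(j, i) \<notin> EP" "i \<noteq> j" using sub loops ij unfolding all_self_loops_def by auto
      then have "Theta_input n c A B D $$ (i, j) = 0" "Theta_direct n c A B D $$ (i, j) = 0"
        using A0 ij by (simp_all add: Theta_input_def Theta_direct_def)
      then show ?thesis
        using Gamma_Theta_index[OF n \<epsilon> A B D ij(1,2), of c] by simp
    qed
    moreover have "proper (Gamma_Theta n c A B D $$ (i, j))" if "i < n" "j < n" for i j
      unfolding Gamma_Theta_eq[OF n \<epsilon> A B D]
      by (rule transfer_matrix_proper[OF Dc(1) c(1) one_carrier_mat c(2) that])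
    moreover have "Gamma_Theta n c A B D \<in> carrier_mat n n"
      by (rule Gamma_Theta_carrier[OF n \<epsilon> A B D])
    ultimately show "Gamma_Theta n c A B D \<in> controllers n (adjacency_mat n EK)"
      unfolding controllers_def by blast
    have "block_diagonal_realization n D (1\<^sub>m n)"
      unfolding block_diagonal_realization_def
    proof (intro exI conjI)
      let ?bl = "\<lambda>f. map (\<lambda>a. mat 1 1 (\<lambda>_. a)) (map f [0..<n]) :: real mat list"
      show "D = diag_block_mat (?bl (\<lambda>i. D $$ (i, i)))"
        unfolding diag_block_mat_singletons using Dc
        by (intro eq_matI) (auto simp: mat_diag_def diagonal_mat_def)
      show "1\<^sub>m n = diag_block_mat (?bl (\<lambda>i. 1))"
        unfolding diag_block_mat_singletons by (intro eq_matI) (auto simp: mat_diag_def)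
    qed auto
    then show "\<exists>A\<^sub>\<Gamma> B\<^sub>\<Gamma> C\<^sub>\<Gamma> D\<^sub>\<Gamma>. realizes n (Gamma_Theta n c A B D) A\<^sub>\<Gamma> B\<^sub>\<Gamma> C\<^sub>\<Gamma> D\<^sub>\<Gamma> \<and>
          block_diagonal_realization n A\<^sub>\<Gamma> C\<^sub>\<Gamma>"
      using Gamma_Theta_realizes[OF n \<epsilon> A B D] by blast
  qed
  moreover have "row (Gamma_Theta n c A B D) i = row (Gamma_Theta n c A' B' D') i"
    if A: "A \<in> A_class n (adjacency_mat n EP)" "A' \<in> A_class n (adjacency_mat n EP)"
      and B: "B \<in> B_class n \<epsilon>" "B' \<in> B_class n \<epsilon>" and D: "D \<in> D_class n" "D' \<in> D_class n"
      and i: "i < n"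
      and eq: "\<forall>j<n. adjacency_mat n EC $$ (i, j) \<noteq> 0 \<longrightarrow>
           row A j = row A' j \<and> B $$ (j, j) = B' $$ (j, j) \<and> D $$ (j, j) = D' $$ (j, j)"
    for A A' B B' D D' i
  proof -
    have Ac: "A \<in> carrier_mat n n" "A' \<in> carrier_mat n n"
      using A unfolding A_class_adjacency_iff by auto
    have "(i, i) \<in> EC" using EC i unfolding totally_disconnected_def by auto
    then have "row A i = row A' i" and e: "B $$ (i, i) = B' $$ (i, i)" "D $$ (i, i) = D' $$ (i, i)"
      using eq i by (auto simp: adjacency_mat_index)
    then have a: "A $$ (i, j) = A' $$ (i, j)" if "j < n" for j
      using Ac i that by (metis carrier_matD index_row(1))
    have g: "gain n c A B i = gain n c A' B' i"
      unfolding gain_def sink_gain_def using a[OF i] e by simp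
    have "Gamma_Theta n c A B D $$ (i, j) = Gamma_Theta n c A' B' D' $$ (i, j)" if "j < n" for j
      unfolding Gamma_Theta_index[OF n \<epsilon> Ac(1) B(1) D(1) i that] Gamma_Theta_index[OF n \<epsilon> Ac(2) B(2) D(2) i that]
      using i that e g a[OF that] by (cases "i = j") (simp_all add: Theta_input_def Theta_direct_def)
    moreover have "Gamma_Theta n c A B D \<in> carrier_mat n n" "Gamma_Theta n c A' B' D' \<in> carrier_mat n n"
      by (rule Gamma_Theta_carrier[OF n \<epsilon> Ac(1) B(1) D(1)], rule Gamma_Theta_carrier[OF n \<epsilon> Ac(2) B(2) D(2)])
    ultimately show ?thesis
      using i by (intro eq_vecI) auto
  qed
  ultimately show ?thesis
    unfolding structured_design_methods_def design_methods_def has_design_structure_def by blast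
qed

section \<open>Response of a single row that deviates from the design\<close>

text \<open>The controller acts as a disturbance observer with one-step memory: its error at
  \<open>k + 1\<close> involves \<delta> at \<open>k\<close> but not the error at \<open>k\<close>.
  So a vanishing \<delta> at the one preceding instant suffices, and for \<open>k = 0\<close> the
  assumption \<open>w\<close> does. Only row \<open>i\<close> is tied to the plant, so anything may
  drive the others.\<close>

lemma Theta_row_response:
  fixes x :: "nat \<Rightarrow> nat \<Rightarrow> real"
  assumes n: "0 < n" and \<epsilon>: "0 < \<epsilon>"
    and A: "A \<in> carrier_mat n n" and B: "B \<in> B_class n \<epsilon>" and D: "D \<in> D_class n"
    and i: "i < n"
    and xS: "\<And>k. x (Suc k) i = (\<Sum>j<n. A $$ (i, j) * x k j) + B $$ (i, i) * v k"
    and v: "\<And>k. v k = markov_output n (Gamma_Theta n c A B D) x k i + D $$ (i, i) ^ k * w + \<delta> k"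
    and w: "B $$ (i, i) * w = D $$ (i, i) * x 0 i"
    and \<delta>: "\<And>l. k = Suc l \<Longrightarrow> \<delta> l = 0"
  shows "B $$ (i, i) * v k = gain n c A B i * (\<Sum>j<n. A $$ (i, j) * x k j) + B $$ (i, i) * \<delta> k"
proof -
  define b d f where "b = B $$ (i, i)" and "d = D $$ (i, i)" and "f = gain n c A B i"
  define y where "y k = (\<Sum>j<n. A $$ (i, j) * x k j)" for k
  define xv where "xv k = vec n (x k)" for k
  define xK where "xK = rec_nat (0\<^sub>v n) (\<lambda>k s. D *\<^sub>v s + Theta_input n c A B D *\<^sub>v xv k)"
  have b0: "b \<noteq> 0"
    unfolding b_def by (rule B_diag_nonzero[OF n \<epsilon> A B D i])
  have Dc: "D \<in> carrier_mat n n" "diagonal_mat D"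
    using D unfolding D_class_def by auto
  have c: "Theta_input n c A B D \<in> carrier_mat n n" "Theta_direct n c A B D \<in> carrier_mat n n"
    unfolding Theta_input_def Theta_direct_def by auto
  have xK0: "xK 0 = 0\<^sub>v (dim_row D)" and xKS: "\<And>k. xK (Suc k) = D *\<^sub>v xK k + Theta_input n c A B D *\<^sub>v xv k"
    unfolding xK_def using Dc by auto
  have xv: "xv k \<in> carrier_vec n" for k unfolding xv_def by simp
  have xK: "xK k \<in> carrier_vec n" for k
    by (induction k) (use Dc c xv xK0 xKS in \<open>auto intro!: add_carrier_vec\<close>)
  have diag_sum: "(\<Sum>j<n. (p * (q * A $$ (i, j) - (if i = j then s else 0)) / t) * x k j) = p * (q * y k - s * x k i) / t"
    for p q s t k
  proof -
    have "(\<Sum>j<n. (p * (q * A $$ (i, j) - (if i = j then s else 0)) / t) * x k j) =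
        (\<Sum>j<n. p * q / t * (A $$ (i, j) * x k j) - (if j = i then p * s / t * x k i else 0))"
      by (intro sum.cong) (auto simp: diff_divide_distrib algebra_simps)
    also have "\<dots> = p * q / t * y k - p * s / t * x k i"
      using i unfolding sum_subtractf y_def by (simp add: sum_distrib_left)
    finally show ?thesis by (simp add: diff_divide_distrib algebra_simps)
  qed
  have x1: "xK 0 $ i = 0" using xK0 Dc i by simp
  have x2: "xK (Suc k) $ i = d * xK k $ i + d * ((f + 1) * y k - d * x k i) / b" for k
  proof -
    have "(D *\<^sub>v xK k) $ i = (\<Sum>j<n. D $$ (i, j) * xK k $ j)"
      using Dc xK i by (intro index_mult_mat_vec_sum)
    also have "\<dots> = (\<Sum>j\<in>{i}. D $$ (i, j) * xK k $ j)"
      using Dc i by (intro sum.mono_neutral_right) (auto simp: diagonal_mat_def)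
    finally have "(D *\<^sub>v xK k) $ i = d * xK k $ i" by (simp add: d_def)
    moreover have "(Theta_input n c A B D *\<^sub>v xv k) $ i = (\<Sum>j<n. Theta_input n c A B D $$ (i, j) * xv k $ j)"
      using c xv i by (intro index_mult_mat_vec_sum)
    then have "(Theta_input n c A B D *\<^sub>v xv k) $ i =
        (\<Sum>j<n. (d * ((f + 1) * A $$ (i, j) - (if i = j then d else 0)) / b) * x k j)"
      using i unfolding b_def d_def f_def by (simp add: Theta_input_def xv_def)
    ultimately show ?thesis
      unfolding diag_sum xKS using Dc c xK xv i by simp
  qed
  have out: "markov_output n (Gamma_Theta n c A B D) x k i = xK k $ i + (f * y k - d * x k i) / b" for k
  proof -
    have "markov_output n (Gamma_Theta n c A B D) x k i = markov_output n (Gamma_Theta n c A B D) (\<lambda>k i. xv k $ i) k i"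
      by (rule markov_output_cong) (simp add: xv_def)
    also have "\<dots> = (1\<^sub>m n *\<^sub>v xK k + Theta_direct n c A B D *\<^sub>v xv k) $ i"
      by (rule state_space_output[symmetric, OF Gamma_Theta_realizes[OF n \<epsilon> A B D] xv xK0 xKS i])
    also have "\<dots> = xK k $ i + (\<Sum>j<n. Theta_direct n c A B D $$ (i, j) * xv k $ j)"
      using xK[of k] c xv[of k] i index_mult_mat_vec_sum[OF c(2) xv[of k] i] by simp
    also have "(\<Sum>j<n. Theta_direct n c A B D $$ (i, j) * xv k $ j) =
        (\<Sum>j<n. (1 * (f * A $$ (i, j) - (if i = j then d else 0)) / b) * x k j)"
      using i unfolding b_def d_def f_def by (simp add: Theta_direct_def xv_def)
    finally show ?thesis unfolding diag_sum by simp
  qed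
  \<comment> \<open>\<open>e\<close> is the part of the disturbance that the controller does not cancel; it satisfies
    \<open>e(k + 1) = - d b \<delta>(k)\<close>.\<close>
  define e where "e k = b * (xK k $ i + d ^ k * w) - d * x k i" for k
  have bv: "b * v k = f * y k + e k + b * \<delta> k" for k
    unfolding v out e_def d_def[symmetric] using b0 by (simp add: field_simps)
  have "e k = 0"
  proof (cases k)
    case 0
    then show ?thesis using w x1 by (simp add: e_def b_def d_def)
  next
    case (Suc l)
    have "x (Suc l) i = y l + b * v l" using xS unfolding y_def b_def .
    then have x3: "x (Suc l) i = (f + 1) * y l + (b * (xK l $ i + d ^ l * w) - d * x l i)"
      using bv[of l] \<delta>[OF Suc] by (simp add: e_def algebra_simps)
    show ?thesis
      unfolding Suc e_def x2 x3 using b0 by (simp add: field_simps)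
  qed
  then show ?thesis using bv[of k] by (simp add: b_def f_def y_def)
qed

text \<open>The deviation is the convolution of the coefficient differences with the state. Up to
  time \<open>k\<close> only the term with the initial state survives, and before \<open>k\<close>
  even that one vanishes.\<close>

lemma loop_response:
  assumes n: "0 < n" and \<epsilon>: "0 < \<epsilon>"
    and A: "A \<in> carrier_mat n n" and B: "B \<in> B_class n \<epsilon>" and D: "D \<in> D_class n"
    and i: "i < n"
    and loop: "loop_signals n (A, B, D, x0, w0) K x v"
    and w: "B $$ (i, i) * w0 $ i = D $$ (i, i) * x0 $ i"
    and agree: "\<And>l j. l < k \<Longrightarrow> j < n \<Longrightarrow>
      markov (K $$ (i, j)) l = markov (Gamma_Theta n c A B D $$ (i, j)) l"
  shows "B $$ (i, i) * v k i = gain n c A B i * (\<Sum>j<n. A $$ (i, j) * x k j)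
    + B $$ (i, i) * (\<Sum>j<n. (markov (K $$ (i, j)) k - markov (Gamma_Theta n c A B D $$ (i, j)) k) * x0 $ j)"
proof -
  note l = loop[unfolded loop_signals_def prod.case]
  let ?h = "\<lambda>j l. markov (K $$ (i, j)) l - markov (Gamma_Theta n c A B D $$ (i, j)) l"
  define \<delta> where "\<delta> k = (\<Sum>l\<le>k. \<Sum>j<n. ?h j (k - l) * x l j)" for k
  have \<delta>: "\<delta> k' = (\<Sum>j<n. ?h j k' * x0 $ j)" if "k' \<le> k" for k'
  proof -
    have "\<delta> k' = (\<Sum>l\<in>{0}. \<Sum>j<n. ?h j (k' - l) * x l j)"
      unfolding \<delta>_def
    proof (rule sum.mono_neutral_right)
      show "\<forall>l\<in>{..k'} - {0}. (\<Sum>j<n. ?h j (k' - l) * x l j) = 0"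
      proof
        fix l assume "l \<in> {..k'} - {0}"
        then have "k' - l < k" using that by auto
        then show "(\<Sum>j<n. ?h j (k' - l) * x l j) = 0" using agree by simp
      qed
    qed auto
    then show ?thesis using l by simp
  qed
  have "B $$ (i, i) * v k i = gain n c A B i * (\<Sum>j<n. A $$ (i, j) * x k j) + B $$ (i, i) * \<delta> k"
  proof (rule Theta_row_response[OF n \<epsilon> A B D i, of x "\<lambda>k. v k i"])
    show "x (Suc k) i = (\<Sum>j<n. A $$ (i, j) * x k j) + B $$ (i, i) * v k i" for k
      using l i by blast
    show "B $$ (i, i) * w0 $ i = D $$ (i, i) * x 0 i" using w l i by simp
    show "v k i = markov_output n (Gamma_Theta n c A B D) x k i + D $$ (i, i) ^ k * w0 $ i + \<delta> k" for k
    proof -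
      have "v k i = markov_output n K x k i + D $$ (i, i) ^ k * w0 $ i" using l i by blast
      then show ?thesis
        unfolding markov_output_def \<delta>_def by (simp add: left_diff_distrib sum_subtractf)
    qed
    show "\<delta> l = 0" if "k = Suc l" for l
      using \<delta>[of l] agree[of l] that by simp
  qed
  then show ?thesis unfolding \<delta>[OF order_refl] .
qed

section \<open>Bounding the cost through finite sums\<close>

text \<open>The cost is regrouped: an input is paid together with the state it produces, the initial
  state separately. Both the one-step bound and the quadratic regulator identity have this
  shape.\<close>

lemma signal_cost_ge:
  assumes "j < n" "finite T"
  shows "ennreal ((\<Sum>i<n. (x 0 i)\<^sup>2) + (\<Sum>k\<in>T. (x (Suc k) j)\<^sup>2 + (v k j)\<^sup>2)) \<le> signal_cost n x v"
proof -
  obtain N where N: "T \<subseteq> {..<N}"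
    using assms(2) finite_nat_iff_bounded by auto
  have "(\<Sum>k\<in>T. (x (Suc k) j)\<^sup>2 + (v k j)\<^sup>2) \<le> (\<Sum>k<N. (x (Suc k) j)\<^sup>2 + (v k j)\<^sup>2)"
    using N by (intro sum_mono2) auto
  also have "\<dots> \<le> (\<Sum>k<N. \<Sum>i<n. (x (Suc k) i)\<^sup>2 + (v k i)\<^sup>2)"
    by (rule sum_mono, rule member_le_sum) (use assms in auto)
  also have "(\<Sum>i<n. (x 0 i)\<^sup>2) + \<dots> \<le> (\<Sum>k<Suc N. \<Sum>i<n. (x k i)\<^sup>2) + (\<Sum>k<Suc N. \<Sum>i<n. (v k i)\<^sup>2)"
    unfolding sum.distrib sum.lessThan_Suc_shift[of "\<lambda>k. \<Sum>i<n. (x k i)\<^sup>2"] by (simp add: sum_nonneg)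
  also have "\<dots> = (\<Sum>k<Suc N. \<Sum>i<n. (x k i)\<^sup>2 + (v k i)\<^sup>2)"
    by (simp add: sum.distrib)
  finally have "ennreal ((\<Sum>i<n. (x 0 i)\<^sup>2) + (\<Sum>k\<in>T. (x (Suc k) j)\<^sup>2 + (v k j)\<^sup>2))
      \<le> ennreal (\<Sum>k<Suc N. \<Sum>i<n. (x k i)\<^sup>2 + (v k i)\<^sup>2)"
    by (intro ennreal_leI) simp
  also have "\<dots> = (\<Sum>k<Suc N. ennreal (\<Sum>i<n. (x k i)\<^sup>2 + (v k i)\<^sup>2))"
    by (rule sum_ennreal[symmetric]) (simp add: sum_nonneg)
  also have "\<dots> \<le> signal_cost n x v"
    unfolding signal_cost_def by (rule sum_le_suminf) auto
  finally show ?thesis .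
qed

lemma signal_cost_le:
  assumes "\<And>N. (\<Sum>k<N. \<Sum>i<n. (x (Suc k) i)\<^sup>2 + (v k i)\<^sup>2) \<le> C"
  shows "signal_cost n x v \<le> ennreal ((\<Sum>i<n. (x 0 i)\<^sup>2) + C)"
  unfolding signal_cost_def
proof (rule suminf_le_const)
  fix N
  have "(\<Sum>k<N. ennreal (\<Sum>i<n. (x k i)\<^sup>2 + (v k i)\<^sup>2)) = ennreal (\<Sum>k<N. \<Sum>i<n. (x k i)\<^sup>2 + (v k i)\<^sup>2)"
    by (rule sum_ennreal) (simp add: sum_nonneg)
  also have "\<dots> \<le> ennreal ((\<Sum>i<n. (x 0 i)\<^sup>2) + C)"
  proof (rule ennreal_leI)
    have "(\<Sum>k<N. \<Sum>i<n. (x k i)\<^sup>2 + (v k i)\<^sup>2) =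
        (\<Sum>k<N. \<Sum>i<n. (x k i)\<^sup>2) + (\<Sum>k<N. \<Sum>i<n. (v k i)\<^sup>2)"
      by (simp add: sum.distrib)
    also have "(\<Sum>k<N. \<Sum>i<n. (x k i)\<^sup>2) \<le> (\<Sum>k<Suc N. \<Sum>i<n. (x k i)\<^sup>2)"
      by (simp add: sum_nonneg)
    also have "\<dots> = (\<Sum>i<n. (x 0 i)\<^sup>2) + (\<Sum>k<N. \<Sum>i<n. (x (Suc k) i)\<^sup>2)"
      by (rule sum.lessThan_Suc_shift)
    finally show "(\<Sum>k<N. \<Sum>i<n. (x k i)\<^sup>2 + (v k i)\<^sup>2) \<le> (\<Sum>i<n. (x 0 i)\<^sup>2) + C"
      using assms[of N] by (simp add: sum.distrib)
  qed
  finally show "(\<Sum>k<N. ennreal (\<Sum>i<n. (x k i)\<^sup>2 + (v k i)\<^sup>2)) \<le> ennreal ((\<Sum>i<n. (x 0 i)\<^sup>2) + C)" .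
qed simp

section \<open>Scalar linear quadratic regulation\<close>

text \<open>The larger root of \<open>t\<^sup>2 - (1 + a\<^sup>2 + b\<^sup>2) t + a\<^sup>2 = 0\<close>; then \<open>m = (t - 1) / b\<^sup>2\<close> solves the
  Riccati equation \<open>m = 1 + a\<^sup>2 m / (1 + m b\<^sup>2)\<close>.\<close>

definition lqr_t :: "real \<Rightarrow> real \<Rightarrow> real" where
  "lqr_t a b = (b\<^sup>2 + a\<^sup>2 + 1 + sqrt (a^4 + 2 * a\<^sup>2 * b\<^sup>2 - 2 * a\<^sup>2 + b^4 + 2 * b\<^sup>2 + 1)) / 2"

lemma sink_gain_eq: "sink_gain A B i = 1 / lqr_t (A $$ (i, i)) (B $$ (i, i)) - 1"
  unfolding sink_gain_def lqr_t_def Let_def by simp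

text \<open>The case of a sink \<open>j\<close> of a probe plant, whose diagonal entry there is
  0.\<close>

lemma lqr_t_0: "lqr_t 0 b = 1 + b\<^sup>2"
proof -
  have "(0::real)^4 + 2 * 0\<^sup>2 * b\<^sup>2 - 2 * 0\<^sup>2 + b^4 + 2 * b\<^sup>2 + 1 = (b\<^sup>2 + 1)\<^sup>2"
    by (simp add: power2_eq_square power4_eq_xxxx algebra_simps)
  then show ?thesis unfolding lqr_t_def by simp
qed

lemma
  assumes "b \<noteq> 0"
  shows lqr_t_gt_1: "1 < lqr_t a b"
    and lqr_t_root: "(lqr_t a b)\<^sup>2 - (1 + a\<^sup>2 + b\<^sup>2) * lqr_t a b + a\<^sup>2 = 0"
proof -
  define s where "s = a^4 + 2 * a\<^sup>2 * b\<^sup>2 - 2 * a\<^sup>2 + b^4 + 2 * b\<^sup>2 + 1"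
  have b: "b\<^sup>2 > 0" using assms by simp
  \<comment> \<open>The first form gives positivity and \<open>t > 1\<close>; the second is the
    discriminant of the quadratic equation.\<close>
  have s1: "s = (1 - a\<^sup>2 - b\<^sup>2)\<^sup>2 + 4 * b\<^sup>2" and s2: "s = (1 + a\<^sup>2 + b\<^sup>2)\<^sup>2 - 4 * a\<^sup>2"
    unfolding s_def by (simp_all add: power2_eq_square power4_eq_xxxx algebra_simps)
  have "\<bar>1 - a\<^sup>2 - b\<^sup>2\<bar> < sqrt s"
    using b by (intro real_less_rsqrt) (simp add: s1)
  then show "1 < lqr_t a b"
    unfolding lqr_t_def s_def[symmetric] by simp
  have "0 \<le> s" using s1 b by simp
  then have ss: "(sqrt s)\<^sup>2 = (1 + a\<^sup>2 + b\<^sup>2)\<^sup>2 - 4 * a\<^sup>2" using s2 by simp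
  have "(lqr_t a b)\<^sup>2 - (1 + a\<^sup>2 + b\<^sup>2) * lqr_t a b + a\<^sup>2 = ((sqrt s)\<^sup>2 - ((1 + a\<^sup>2 + b\<^sup>2)\<^sup>2 - 4 * a\<^sup>2)) / 4"
    unfolding lqr_t_def s_def[symmetric] by (simp add: power2_eq_square field_simps)
  then show "(lqr_t a b)\<^sup>2 - (1 + a\<^sup>2 + b\<^sup>2) * lqr_t a b + a\<^sup>2 = 0"
    unfolding ss by simp
qed

text \<open>\<open>q y\<^sup>2\<close> is the optimal cost-to-go from \<open>x = y + b v\<close> before the input \<open>v\<close> is chosen.\<close>

lemma lqr_square:
  fixes a b y v :: real
  assumes b: "b \<noteq> 0"
  defines "t \<equiv> lqr_t a b"
  defines "q \<equiv> (t - 1) / (b\<^sup>2 * t)"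
  shows "0 < q"
    and "(y + b * v)\<^sup>2 + v\<^sup>2 + q * (a * (y + b * v))\<^sup>2 = q * y\<^sup>2 + t * (v - (1 / t - 1) / b * y)\<^sup>2"
proof -
  have t: "1 < t" and r: "t\<^sup>2 - (1 + a\<^sup>2 + b\<^sup>2) * t + a\<^sup>2 = 0"
    unfolding t_def using lqr_t_gt_1[OF b] lqr_t_root[OF b] by auto
  have b2: "0 < b\<^sup>2" using b by simp
  then show "0 < q" unfolding q_def using t by simp
  define M where "M = (t - 1) / b\<^sup>2"
  have Mb: "M * b\<^sup>2 = t - 1" and qM: "q = M / t"
    unfolding M_def q_def using b by simp_all
  \<comment> \<open>The Riccati equation: \<open>M x^2\<close> is the cost from the state
    \<open>x\<close> onwards, including \<open>x^2\<close> itself.\<close>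
  have m: "1 + q * a\<^sup>2 = M"
  proof -
    have "b\<^sup>2 * (t + M * a\<^sup>2) = t * b\<^sup>2 + (M * b\<^sup>2) * a\<^sup>2" by (simp add: algebra_simps)
    also have "\<dots> = (M * b\<^sup>2) * t"
      unfolding Mb using r by (simp add: power2_eq_square algebra_simps)
    finally have "b\<^sup>2 * (t + M * a\<^sup>2) = b\<^sup>2 * (M * t)" by (simp add: algebra_simps)
    then have "t + M * a\<^sup>2 = M * t" using b2 by simp
    then show ?thesis unfolding qM using t by (simp add: field_simps)
  qed
  have g: "(1 / t - 1) / b = - (M * b / t)"
    unfolding M_def using t b by (simp add: power2_eq_square field_simps)
  have "(y + b * v)\<^sup>2 + v\<^sup>2 + q * (a * (y + b * v))\<^sup>2 = (1 + q * a\<^sup>2) * (y + b * v)\<^sup>2 + v\<^sup>2"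
    unfolding power_mult_distrib by (simp add: algebra_simps)
  also have "\<dots> = (t * (M * (y + b * v)\<^sup>2 + v\<^sup>2)) / t"
    unfolding m using t by simp
  also have "t * (M * (y + b * v)\<^sup>2 + v\<^sup>2) = M * y\<^sup>2 + (t * v + M * b * y)\<^sup>2"
  proof -
    have "t = 1 + M * b\<^sup>2" using Mb by simp
    then show ?thesis by (simp only:) (simp add: power2_eq_square algebra_simps)
  qed
  also have "\<dots> / t = q * y\<^sup>2 + t * (v - (1 / t - 1) / b * y)\<^sup>2"
    unfolding g qM using t by (simp add: power2_eq_square field_simps)
  finally show "(y + b * v)\<^sup>2 + v\<^sup>2 + q * (a * (y + b * v))\<^sup>2 = q * y\<^sup>2 + t * (v - (1 / t - 1) / b * y)\<^sup>2" .
qed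

text \<open>Summing \<open>lqr_square\<close> along a trajectory cancels the costs-to-go except the
  first and the last, plus a penalty for every non-optimal input.\<close>

lemma lqr_telescope:
  fixes x v y :: "nat \<Rightarrow> real"
  assumes b: "b \<noteq> 0" and x: "\<And>k. x (Suc k) = y k + b * v k" and y: "\<And>k. y (Suc k) = a * x (Suc k)"
  defines "t \<equiv> lqr_t a b"
  defines "q \<equiv> (t - 1) / (b\<^sup>2 * t)"
  shows "(\<Sum>k<N. (x (Suc k))\<^sup>2 + (v k)\<^sup>2) =
    q * (y 0)\<^sup>2 - q * (y N)\<^sup>2 + t * (\<Sum>k<N. (v k - (1 / t - 1) / b * y k)\<^sup>2)"
proof (induction N)
  case (Suc N)
  have "(x (Suc N))\<^sup>2 + (v N)\<^sup>2 + q * (y (Suc N))\<^sup>2 = q * (y N)\<^sup>2 + t * (v N - (1 / t - 1) / b * y N)\<^sup>2"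
    using lqr_square(2)[OF b, of "y N" "v N" a] unfolding y x t_def q_def .
  then show ?case using Suc by (simp add: algebra_simps)
qed simp

text \<open>Bounded cost forces \<open>x\<close> to 0 and with it the final cost-to-go, which by
  \<open>lqr_telescope\<close> dominates every penalty. Stability is thus derived rather than
  assumed.\<close>

lemma lqr_optimal_unique:
  fixes x v y :: "nat \<Rightarrow> real"
  assumes b: "b \<noteq> 0" and x: "\<And>k. x (Suc k) = y k + b * v k" and y: "\<And>k. y (Suc k) = a * x (Suc k)"
  defines "t \<equiv> lqr_t a b"
  defines "q \<equiv> (t - 1) / (b\<^sup>2 * t)"
  assumes le: "\<And>N. (\<Sum>k<N. (x (Suc k))\<^sup>2 + (v k)\<^sup>2) \<le> q * (y 0)\<^sup>2"
  shows "v k = (1 / t - 1) / b * y k"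
proof -
  let ?d = "\<lambda>k. (v k - (1 / t - 1) / b * y k)\<^sup>2"
  have t: "1 < t" unfolding t_def using lqr_t_gt_1[OF b] .
  have sm: "summable (\<lambda>k. (x (Suc k))\<^sup>2 + (v k)\<^sup>2)"
    by (rule summableI_nonneg_bounded[of _ "q * (y 0)\<^sup>2"]) (use le in auto)
  have "(\<lambda>k. (x (Suc k))\<^sup>2) \<longlonglongrightarrow> 0"
    by (rule summable_LIMSEQ_zero, rule summable_comparison_test'[OF sm, of 0]) auto
  then have "(\<lambda>k. q * a\<^sup>2 * (x (Suc k))\<^sup>2) \<longlonglongrightarrow> 0"
    using tendsto_mult_right_zero by blast
  moreover have "t * ?d k \<le> q * a\<^sup>2 * (x (Suc N))\<^sup>2" if "k \<le> N" for N
  proof -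
    have "?d k \<le> (\<Sum>k<Suc N. ?d k)"
      using that by (intro member_le_sum) auto
    then have "t * ?d k \<le> t * (\<Sum>k<Suc N. ?d k)" using t by simp
    also have "\<dots> \<le> q * (y (Suc N))\<^sup>2"
      using le[of "Suc N"] lqr_telescope[of b x y v a "Suc N", OF b x y] unfolding t_def q_def by linarith
    finally show ?thesis unfolding y by (simp add: power_mult_distrib mult.assoc)
  qed
  then have "\<forall>N\<ge>k. t * ?d k \<le> q * a\<^sup>2 * (x (Suc N))\<^sup>2" by blast
  ultimately have "t * ?d k \<le> 0"
    by (intro LIMSEQ_le_const) auto
  then have "?d k \<le> 0" using t by (simp add: mult_le_0_iff)
  then show ?thesis by simp
qed

text \<open>Completing the square; the left side is the minimum over \<open>v\<close>, attained at
  \<open>v = - b p / (1 + b^2)\<close>.\<close>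

lemma one_step_cost_ge:
  fixes p b v :: real
  shows "p\<^sup>2 / (1 + b\<^sup>2) \<le> (p + b * v)\<^sup>2 + v\<^sup>2"
proof -
  have "(1 + b\<^sup>2) * ((p + b * v)\<^sup>2 + v\<^sup>2) - p\<^sup>2 = ((1 + b\<^sup>2) * v + b * p)\<^sup>2"
    by (simp add: power2_eq_square algebra_simps)
  then have "p\<^sup>2 \<le> (1 + b\<^sup>2) * ((p + b * v)\<^sup>2 + v\<^sup>2)"
    by (metis diff_ge_0_iff_ge zero_le_power2)
  moreover have "0 < 1 + b\<^sup>2" by (simp add: add_pos_nonneg)
  ultimately show ?thesis by (simp add: pos_divide_le_eq mult.commute)
qed

section \<open>Comparison on test plants\<close>

lemma structured_row_cong:
  assumes M: "M \<in> structured_design_methods n \<epsilon> EP EK EC" and EC: "totally_disconnected n EC"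
    and A: "A \<in> A_class n (adjacency_mat n EP)" "A' \<in> A_class n (adjacency_mat n EP)"
    and B: "B \<in> B_class n \<epsilon>" "B' \<in> B_class n \<epsilon>" and D: "D \<in> D_class n" "D' \<in> D_class n"
    and i: "i < n" and m: "m < n"
    and eq: "\<And>j. j < n \<Longrightarrow> A $$ (i, j) = A' $$ (i, j)" "B $$ (i, i) = B' $$ (i, i)" "D $$ (i, i) = D' $$ (i, i)"
  shows "M A B D $$ (i, m) = M A' B' D' $$ (i, m)"
proof -
  have Ac: "A \<in> carrier_mat n n" "A' \<in> carrier_mat n n"
    using A unfolding A_class_adjacency_iff by auto
  have Mc: "M A B D \<in> carrier_mat n n" "M A' B' D' \<in> carrier_mat n n"
    using M A B D unfolding structured_design_methods_def design_methods_def controllers_def by blast+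
  have only: "j = i" if "j < n" "adjacency_mat n EC $$ (i, j) \<noteq> 0" for j
    using that EC i unfolding totally_disconnected_def by (auto simp: adjacency_mat_index split: if_splits)
  have "row A i = row A' i"
    using Ac i eq(1) by (intro eq_vecI) auto
  then have "\<forall>j<n. adjacency_mat n EC $$ (i, j) \<noteq> 0 \<longrightarrow>
      row A j = row A' j \<and> B $$ (j, j) = B' $$ (j, j) \<and> D $$ (j, j) = D' $$ (j, j)"
    using only eq by blast
  then have "row (M A B D) i = row (M A' B' D') i"
    using M A B D i unfolding structured_design_methods_def has_design_structure_def by blast
  from arg_cong[OF this, of "\<lambda>v. v $ m"] show ?thesis using Mc i m by simp
qed

lemma structured_signals:
  assumes M: "M \<in> structured_design_methods n \<epsilon> EP EK EC"
    and P: "(A, B, D, x0, w0) \<in> plants n \<epsilon> EP"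
  obtains x v where "loop_signals n (A, B, D, x0, w0) (M A B D) x v"
    "cost n (A, B, D, x0, w0) (M A B D) = signal_cost n x v"
proof -
  have c: "A \<in> A_class n (adjacency_mat n EP)" "B \<in> B_class n \<epsilon>" "D \<in> D_class n"
    "x0 \<in> carrier_vec n" "w0 \<in> carrier_vec n"
    using P unfolding plants_def by auto
  obtain AK BK CK DK where "realizes n (M A B D) AK BK CK DK"
    using M c unfolding structured_design_methods_def design_methods_def by blast
  then show thesis
    using cost_eq_signal_cost[of A n B D x0 w0 "M A B D" AK BK CK DK] c that
    unfolding A_class_def B_class_def D_class_def by blast
qed

text \<open>The plants on which a competitor is tested: only row \<open>i\<close> carries the given data, node \<open>j\<close>
  is driven by node \<open>i\<close> with gain \<open>r\<close>, and \<open>w\<^sub>0 = B\<^sup>-\<^sup>1 D x\<^sub>0\<close>, the disturbance that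
  \<open>Gamma_Theta\<close> guesses from \<open>x\<^sub>0\<close>.\<close>

definition probe_A :: "nat \<Rightarrow> real mat \<Rightarrow> nat \<Rightarrow> nat \<Rightarrow> real \<Rightarrow> real mat" where
  "probe_A n A i j r = mat n n (\<lambda>(l, m). if l = i then A $$ (i, m) else if l = j \<and> m = i then r else 0)"

definition probe_B :: "nat \<Rightarrow> real \<Rightarrow> real mat \<Rightarrow> nat \<Rightarrow> nat \<Rightarrow> real \<Rightarrow> real mat" where
  "probe_B n \<epsilon> B i j b = mat_diag n (\<lambda>l. if l = i then B $$ (i, i) else if l = j then b else \<epsilon>)"

definition probe_D :: "nat \<Rightarrow> real mat \<Rightarrow> nat \<Rightarrow> real mat" where
  "probe_D n D i = mat_diag n (\<lambda>l. if l = i then D $$ (i, i) else 0)"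

definition probe_w :: "nat \<Rightarrow> real mat \<Rightarrow> real mat \<Rightarrow> nat \<Rightarrow> nat \<Rightarrow> real vec" where
  "probe_w n B D i m = vec n (\<lambda>l. if l = i then D $$ (i, i) * unit_vec n m $ i / B $$ (i, i) else 0)"

text \<open>Only the weak half of domination is assumed. The aim is \<open>cost_eq\<close>, equal
  cost on every plant, which contradicts the strict half.\<close>

locale competitor =
  fixes n c :: nat and \<epsilon> :: real and EP EK EC :: "(nat \<times> nat) set" and \<Gamma> :: design_method
  assumes n: "0 < n" and \<epsilon>: "0 < \<epsilon>" and EC: "totally_disconnected n EC"
    and sink: "\<And>i l. n - c \<le> i \<Longrightarrow> i < n \<Longrightarrow> l \<noteq> i \<Longrightarrow> (i, l) \<notin> EP"
    and nonsink: "\<And>i. i < n - c \<Longrightarrow> \<exists>j<n. j \<noteq> i \<and> (i, j) \<in> EP"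
    and Theta: "Gamma_Theta n c \<in> structured_design_methods n \<epsilon> EP EK EC"
    and Gamma: "\<Gamma> \<in> structured_design_methods n \<epsilon> EP EK EC"
    and cost_le: "\<And>A B D x0 w0. (A, B, D, x0, w0) \<in> plants n \<epsilon> EP \<Longrightarrow>
      cost n (A, B, D, x0, w0) (\<Gamma> A B D) \<le> cost n (A, B, D, x0, w0) (Gamma_Theta n c A B D)"
begin

section \<open>Signals on a probe plant\<close>

context
  fixes A B D :: "real mat" and i j m :: nat and r b :: real
  assumes A: "A \<in> A_class n (adjacency_mat n EP)" and B: "B \<in> B_class n \<epsilon>" and D: "D \<in> D_class n"
    and i: "i < n" and j: "j < n" and m: "m < n" and b: "\<epsilon> \<le> b" and ij: "j = i \<or> (i, j) \<in> EP"
begin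

abbreviation "A\<^sub>p \<equiv> probe_A n A i j r"
abbreviation "B\<^sub>p \<equiv> probe_B n \<epsilon> B i j b"
abbreviation "D\<^sub>p \<equiv> probe_D n D i"
abbreviation "w\<^sub>p \<equiv> probe_w n B D i m"
abbreviation "P\<^sub>p \<equiv> (A\<^sub>p, B\<^sub>p, D\<^sub>p, unit_vec n m, w\<^sub>p)"

lemma probe_A_class: "A\<^sub>p \<in> A_class n (adjacency_mat n EP)"
  using A ij unfolding A_class_adjacency_iff probe_A_def by auto

lemma probe_B_class: "B\<^sub>p \<in> B_class n \<epsilon>"
  using B b \<epsilon> i unfolding B_class_iff[OF n] by (auto simp: probe_B_def mat_diag_def diagonal_mat_def)

lemma probe_D_class: "D\<^sub>p \<in> D_class n"
  unfolding D_class_def probe_D_def by (auto simp: mat_diag_def diagonal_mat_def)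

lemma probe_plant: "P\<^sub>p \<in> plants n \<epsilon> EP"
  unfolding plants_def using probe_A_class probe_B_class probe_D_class by (simp add: probe_w_def)

lemma probe_A_carrier: "A\<^sub>p \<in> carrier_mat n n"
  unfolding probe_A_def by simp

lemma B_nonzero: "B $$ (i, i) \<noteq> 0"
  using B i \<epsilon> unfolding B_class_iff[OF n] by force

lemma probe_w: "l < n \<Longrightarrow> B\<^sub>p $$ (l, l) * w\<^sub>p $ l = D\<^sub>p $$ (l, l) * unit_vec n m $ l"
  using B_nonzero by (auto simp: probe_w_def probe_B_def probe_D_def mat_diag_def)

lemma probe_row_sum:
  assumes "l < n"
  shows "(\<Sum>k<n. A\<^sub>p $$ (l, k) * x k) = (if l = i then \<Sum>k<n. A $$ (i, k) * x k else if l = j then r * x i else 0)"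
proof -
  have "(\<Sum>k<n. A\<^sub>p $$ (l, k) * x k) =
      (\<Sum>k<n. if l = i then A $$ (i, k) * x k else if k = i then (if l = j then r * x i else 0) else 0)"
    using assms by (intro sum.cong) (auto simp: probe_A_def)
  then show ?thesis using i by (cases "l = i") (simp_all)
qed

lemma probe_B_i: "B\<^sub>p $$ (i, i) = B $$ (i, i)"
  using i by (simp add: probe_B_def mat_diag_def)

lemma probe_gain: "gain n c A\<^sub>p B\<^sub>p i = gain n c A B i"
  using i by (simp add: gain_def sink_gain_def probe_A_def probe_B_def mat_diag_def)

lemma probe_row_cong:
  assumes "M \<in> structured_design_methods n \<epsilon> EP EK EC" "k < n"
  shows "M A\<^sub>p B\<^sub>p D\<^sub>p $$ (i, k) = M A B D $$ (i, k)"
  by (rule structured_row_cong[OF assms(1) EC probe_A_class A probe_B_class B probe_D_class D i assms(2)])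
    (use i in \<open>auto simp: probe_A_def probe_B_def probe_D_def mat_diag_def\<close>)

lemma probe_initial_cost: "loop_signals n P\<^sub>p K x v \<Longrightarrow> (\<Sum>l<n. (x 0 l)\<^sup>2) = 1"
proof -
  assume "loop_signals n P\<^sub>p K x v"
  then have "(\<Sum>l<n. (x 0 l)\<^sup>2) = (\<Sum>l<n. if l = m then 1 else 0)"
    unfolding loop_signals_def by (intro sum.cong) (auto simp: unit_vec_def)
  then show ?thesis using m by simp
qed

text \<open>The unit initial vector selects column \<open>m\<close> of the deviation. The
  disturbance guess is right in all rows, so any row \<open>l\<close> may be read, and for
  \<open>Gamma_Theta\<close> itself the deviation vanishes.\<close>

lemma probe_response:
  assumes loop: "loop_signals n P\<^sub>p K x v" and l: "l < n"
    and agree: "\<And>k' q. k' < k \<Longrightarrow> q < n \<Longrightarrow>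
      markov (K $$ (l, q)) k' = markov (Gamma_Theta n c A\<^sub>p B\<^sub>p D\<^sub>p $$ (l, q)) k'"
  shows "B\<^sub>p $$ (l, l) * v k l = gain n c A\<^sub>p B\<^sub>p l * (\<Sum>q<n. A\<^sub>p $$ (l, q) * x k q)
    + B\<^sub>p $$ (l, l) * (markov (K $$ (l, m)) k - markov (Gamma_Theta n c A\<^sub>p B\<^sub>p D\<^sub>p $$ (l, m)) k)"
proof -
  have "(\<Sum>q<n. (markov (K $$ (l, q)) k - markov (Gamma_Theta n c A\<^sub>p B\<^sub>p D\<^sub>p $$ (l, q)) k) * unit_vec n m $ q) =
      (\<Sum>q<n. if q = m then markov (K $$ (l, m)) k - markov (Gamma_Theta n c A\<^sub>p B\<^sub>p D\<^sub>p $$ (l, m)) k else 0)"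
    using m by (intro sum.cong) (auto simp: unit_vec_def)
  then show ?thesis
    using loop_response[OF n \<epsilon> probe_A_carrier probe_B_class probe_D_class l loop probe_w[OF l] agree] m
    by simp
qed

lemma probe_state:
  assumes loop: "loop_signals n P\<^sub>p K x v" and l: "l < n"
  shows "x (Suc k) l = (\<Sum>q<n. A\<^sub>p $$ (l, q) * x k q) + B\<^sub>p $$ (l, l) * v k l"
  using loop l unfolding loop_signals_def by auto

lemma probe_state_0:
  assumes loop: "loop_signals n P\<^sub>p K x v" and l: "l < n"
  shows "x 0 l = (if l = m then 1 else 0)"
  using loop l m unfolding loop_signals_def by (auto simp: unit_vec_def)

lemma probe_B_nonzero: "l < n \<Longrightarrow> B\<^sub>p $$ (l, l) \<noteq> 0"
  using probe_B_class \<epsilon> unfolding B_class_iff[OF n] by force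

lemma probe_signals_le:
  obtains x v x' v' where
    "loop_signals n P\<^sub>p (\<Gamma> A\<^sub>p B\<^sub>p D\<^sub>p) x v" "loop_signals n P\<^sub>p (Gamma_Theta n c A\<^sub>p B\<^sub>p D\<^sub>p) x' v'"
    "signal_cost n x v \<le> signal_cost n x' v'"
  using structured_signals[OF Gamma probe_plant] structured_signals[OF Theta probe_plant] cost_le[OF probe_plant]
  by metis

end

text \<open>If row \<open>i\<close> of a non-sink first deviates at time \<open>k\<close>, then \<open>x\<^sub>i(k + 1) \<noteq> 0\<close>, whose effect on
  node \<open>j\<close> is expensive for a large gain \<open>r\<close>; choosing \<open>b\<close> large makes the deadbeat input
  of node \<open>j\<close> almost optimal, so that nothing can be saved elsewhere.\<close>

lemma nonsink_markov_eq:
  assumes A: "A \<in> A_class n (adjacency_mat n EP)" and B: "B \<in> B_class n \<epsilon>" and D: "D \<in> D_class n"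
    and i: "i < n - c" and m: "m < n"
  shows "markov (\<Gamma> A B D $$ (i, m)) k = markov (Gamma_Theta n c A B D $$ (i, m)) k"
  using m
proof (induction k arbitrary: m rule: less_induct)
  case (less k)
  define \<delta> where "\<delta> = markov (\<Gamma> A B D $$ (i, m)) k - markov (Gamma_Theta n c A B D $$ (i, m)) k"
  \<comment> \<open>On the probe, \<open>X\<close> will be the state of node \<open>i\<close> at
    time \<open>k + 1\<close>, \<open>z\<close> its initial state, and \<open>Y\<close> its squared
    first input under \<open>Gamma_Theta\<close>.\<close>
  define X where "X = B $$ (i, i) * \<delta>"
  define z :: real where "z = (if i = m then 1 else 0)"
  define Y where "Y = (A $$ (i, m) / B $$ (i, i))\<^sup>2"
  have i': "i < n" using i by simp
  obtain j where j: "j < n" "j \<noteq> i" "(i, j) \<in> EP" using nonsink[OF i] by blast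
  have Bi: "B $$ (i, i) \<noteq> 0"
    using B i' \<epsilon> unfolding B_class_iff[OF n] by force
  \<comment> \<open>Left: what node \<open>j\<close> costs the competitor at least, being pushed by
    \<open>r z\<close> at time 0 and by \<open>r X\<close> at time \<open>k + 1\<close>. Right: what
    \<open>Gamma_Theta\<close> costs at most. The initial state adds 1 to both.\<close>
  have bound: "r\<^sup>2 * (z\<^sup>2 + X\<^sup>2) / (1 + b\<^sup>2) \<le> Y + r\<^sup>2 * z\<^sup>2 / b\<^sup>2" if b: "\<epsilon> \<le> b" for r b
  proof -
    have b0: "0 < b" using b \<epsilon> by simp
    have "j = i \<or> (i, j) \<in> EP" using j by simp
    note pr = A B D i' j(1) less.prems b this
    let ?A = "probe_A n A i j r" and ?B = "probe_B n \<epsilon> B i j b" and ?D = "probe_D n D i"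
    let ?P = "(?A, ?B, ?D, unit_vec n m, probe_w n B D i m)"
    obtain x v x' v' where
      L: "loop_signals n ?P (\<Gamma> ?A ?B ?D) x v" and L': "loop_signals n ?P (Gamma_Theta n c ?A ?B ?D) x' v'"
      and le: "signal_cost n x v \<le> signal_cost n x' v'"
      using probe_signals_le[OF pr] by blast
    note rs = probe_row_sum[OF pr]
    have Bj: "?B $$ (j, j) = b" using j by (simp add: probe_B_def mat_diag_def)
    have gi: "gain n c ?A ?B i = -1" using i by (simp add: gain_def)
    note dyn = probe_state[OF pr L] and dyn' = probe_state[OF pr L']
    have resp': "?B $$ (l, l) * v' k l = gain n c ?A ?B l * (\<Sum>q<n. ?A $$ (l, q) * x' k q)" if "l < n" for l k
      using probe_response[OF pr L' that, of k] by simp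
    \<comment> \<open>Row \<open>i\<close> of both controllers is the same on the probe as on the
      given plant, so the induction hypothesis transfers; the gain -1 then leaves only the
      deviation.\<close>
    have xi: "x (Suc k) i = X"
    proof -
      have "?B $$ (i, i) * v k i = gain n c ?A ?B i * (\<Sum>q<n. ?A $$ (i, q) * x k q) + ?B $$ (i, i) *
          (markov (\<Gamma> ?A ?B ?D $$ (i, m)) k - markov (Gamma_Theta n c ?A ?B ?D $$ (i, m)) k)"
        by (rule probe_response[OF pr L i'])
          (simp only: probe_row_cong[OF pr Gamma] probe_row_cong[OF pr Theta] less.IH)
      then show ?thesis
        unfolding dyn[OF i'] gi X_def \<delta>_def probe_row_cong[OF pr Gamma less.prems] probe_row_cong[OF pr Theta less.prems]
        by (simp add: probe_B_i[OF pr])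
    qed
    have z0: "x 0 i = z" "x' 0 i = z"
      using probe_state_0[OF pr L i'] probe_state_0[OF pr L' i'] unfolding z_def by auto
    have step: "(r * x k i)\<^sup>2 / (1 + b\<^sup>2) \<le> (x (Suc k) j)\<^sup>2 + (v k j)\<^sup>2" for k
      unfolding dyn[OF j(1)] Bj using one_step_cost_ge[of "r * x k i" b "v k j"] rs[OF j(1)] j(2) by simp
    have lower: "ennreal (1 + r\<^sup>2 * (z\<^sup>2 + X\<^sup>2) / (1 + b\<^sup>2)) \<le> signal_cost n x v"
    proof -
      have "r\<^sup>2 * (z\<^sup>2 + X\<^sup>2) / (1 + b\<^sup>2) = (\<Sum>k'\<in>{0, Suc k}. (r * x k' i)\<^sup>2 / (1 + b\<^sup>2))"
        using xi z0 by (simp add: power_mult_distrib add_divide_distrib distrib_left)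
      also have "\<dots> \<le> (\<Sum>k'\<in>{0, Suc k}. (x (Suc k') j)\<^sup>2 + (v k' j)\<^sup>2)"
        by (rule sum_mono) (rule step)
      finally have "ennreal (1 + r\<^sup>2 * (z\<^sup>2 + X\<^sup>2) / (1 + b\<^sup>2)) \<le>
          ennreal ((\<Sum>l<n. (x 0 l)\<^sup>2) + (\<Sum>k'\<in>{0, Suc k}. (x (Suc k') j)\<^sup>2 + (v k' j)\<^sup>2))"
        unfolding probe_initial_cost[OF pr L] by (intro ennreal_leI) simp
      also have "\<dots> \<le> signal_cost n x v" by (rule signal_cost_ge[OF j(1)]) simp
      finally show ?thesis .
    qed
    have upper: "signal_cost n x' v' \<le> ennreal (1 + (Y + r\<^sup>2 * z\<^sup>2 / b\<^sup>2))"
    proof -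
      let ?g = "gain n c ?A ?B j"
      have x'S: "x' (Suc k) l = (1 + gain n c ?A ?B l) * (\<Sum>q<n. ?A $$ (l, q) * x' k q)" if "l < n" for l k
        unfolding dyn'[OF that] resp'[OF that] by (simp add: algebra_simps)
      have other: "x' (Suc k) l = 0" "v' k l = 0" if "l < n" "l \<noteq> i" "l \<noteq> j" for l k
        using x'S[OF that(1)] resp'[OF that(1)] rs[OF that(1)] that probe_B_nonzero[OF pr that(1)] by auto
      have x'i: "x' (Suc k) i = 0" for k
        using x'S[OF i'] gi by simp
      have x'j: "x' (Suc k) j = (1 + ?g) * (r * x' k i)" "b * v' k j = ?g * (r * x' k i)" for k
        using x'S[OF j(1)] resp'[OF j(1), of k] rs[OF j(1)] j(2) Bj by auto
      have v'i: "B $$ (i, i) * v' k i = - (\<Sum>q<n. A $$ (i, q) * x' k q)" for k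
        using resp'[OF i', of k] rs[OF i'] probe_B_i[OF pr] gi by simp
      \<comment> \<open>Either \<open>j\<close> is deadbeat, or it is a sink and has no edge back to
        \<open>i\<close>. In both cases node \<open>i\<close> never feels the state of
        \<open>j\<close> at time 1.\<close>
      have g0: "A $$ (i, j) * (1 + ?g) = 0"
      proof (cases "j < n - c")
        case False
        then have "(j, i) \<notin> EP" using sink j by auto
        then show ?thesis using A i' j unfolding A_class_adjacency_iff by simp
      qed (simp add: gain_def)
      \<comment> \<open>The price of a unit push at \<open>j\<close>: \<open>1 / b^2\<close> for
        deadbeat, and the optimal \<open>1 / (1 + b^2)\<close> if \<open>j\<close> is a
        sink.\<close>
      have gb: "(1 + ?g)\<^sup>2 + (?g / b)\<^sup>2 \<le> 1 / b\<^sup>2"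
      proof (cases "j < n - c")
        case True
        then show ?thesis by (simp add: gain_def power_divide)
      next
        case False
        have Aj: "?A $$ (j, j) = 0" using j by (simp add: probe_A_def)
        have g: "?g = 1 / (1 + b\<^sup>2) - 1"
          using False by (simp add: gain_def sink_gain_eq Aj Bj lqr_t_0)
        have p: "0 < 1 + b\<^sup>2" by (simp add: add_pos_nonneg)
        have "?g = - (b * b / (1 + b\<^sup>2))"
          unfolding g using p by (simp add: field_simps power2_eq_square)
        then have "?g / b = - b / (1 + b\<^sup>2)" using b0 by simp
        then have "(1 + ?g)\<^sup>2 + (?g / b)\<^sup>2 = (1 + b\<^sup>2) / (1 + b\<^sup>2)\<^sup>2"
          unfolding g by (simp add: power_divide add_divide_distrib)
        also have "\<dots> = 1 / (1 + b\<^sup>2)" using p by (simp add: power2_eq_square)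
        also have "\<dots> \<le> 1 / b\<^sup>2" using b0 p by (intro divide_left_mono mult_pos_pos) auto
        finally show ?thesis .
      qed
      have later: "(\<Sum>l<n. (x' (Suc (Suc k)) l)\<^sup>2 + (v' (Suc k) l)\<^sup>2) = 0" for k
      proof -
        have "x' (Suc (Suc k)) l = 0 \<and> v' (Suc k) l = 0" if l: "l < n" for l
        proof -
          consider "l = i" | "l = j" | "l \<noteq> i" "l \<noteq> j" by blast
          then show ?thesis
          proof cases
            case 1
            have "(\<Sum>q<n. A $$ (i, q) * x' (Suc k) q) = (\<Sum>q\<in>{j}. A $$ (i, q) * x' (Suc k) q)"
              using j x'i other(1) by (intro sum.mono_neutral_right) force+
            also have "\<dots> = (A $$ (i, j) * (1 + ?g)) * (r * x' k i)"
              by (simp add: x'j(1))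
            finally have "v' (Suc k) i = 0" using v'i[of "Suc k"] g0 Bi by simp
            then show ?thesis using 1 x'i by simp
          next
            case 2
            then show ?thesis using x'j[of "Suc k"] x'i b0 by simp
          next
            case 3
            then show ?thesis using other l by blast
          qed
        qed
        then show ?thesis by simp
      qed
      have first: "(\<Sum>l<n. (x' (Suc 0) l)\<^sup>2 + (v' 0 l)\<^sup>2) \<le> Y + r\<^sup>2 * z\<^sup>2 / b\<^sup>2"
      proof -
        have "(\<Sum>l<n. (x' (Suc 0) l)\<^sup>2 + (v' 0 l)\<^sup>2) = (\<Sum>l\<in>{i, j}. (x' (Suc 0) l)\<^sup>2 + (v' 0 l)\<^sup>2)"
          using i' j other by (intro sum.mono_neutral_right) auto
        also have "\<dots> = (v' 0 i)\<^sup>2 + ((x' (Suc 0) j)\<^sup>2 + (v' 0 j)\<^sup>2)"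
          using j(2) x'i by simp
        also have "(v' 0 i)\<^sup>2 = Y"
        proof -
          have "(\<Sum>q<n. A $$ (i, q) * x' 0 q) = (\<Sum>q<n. if q = m then A $$ (i, m) else 0)"
            using probe_state_0[OF pr L'] by (intro sum.cong) auto
          then have "v' 0 i = - (A $$ (i, m) / B $$ (i, i))"
            using v'i[of 0] less.prems Bi by (simp add: field_simps)
          then show ?thesis unfolding Y_def by simp
        qed
        also have "(x' (Suc 0) j)\<^sup>2 + (v' 0 j)\<^sup>2 = ((1 + ?g)\<^sup>2 + (?g / b)\<^sup>2) * (r\<^sup>2 * z\<^sup>2)"
        proof -
          have "v' 0 j = ?g / b * (r * z)" using x'j(2)[of 0] z0 b0 by (simp add: field_simps)
          show ?thesis unfolding x'j(1) z0 \<open>v' 0 j = _\<close> power_mult_distrib by (simp only: distrib_right)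
        qed
        also have "\<dots> \<le> 1 / b\<^sup>2 * (r\<^sup>2 * z\<^sup>2)"
          using gb by (intro mult_right_mono) auto
        finally show ?thesis by simp
      qed
      have "(\<Sum>k<N. \<Sum>l<n. (x' (Suc k) l)\<^sup>2 + (v' k l)\<^sup>2) \<le> Y + r\<^sup>2 * z\<^sup>2 / b\<^sup>2" for N
      proof (cases N)
        case 0
        then show ?thesis by (simp add: Y_def)
      next
        case (Suc N')
        show ?thesis unfolding Suc sum.lessThan_Suc_shift later using first by simp
      qed
      from signal_cost_le[OF this] show ?thesis unfolding probe_initial_cost[OF pr L'] .
    qed
    have "ennreal (1 + r\<^sup>2 * (z\<^sup>2 + X\<^sup>2) / (1 + b\<^sup>2)) \<le> ennreal (1 + (Y + r\<^sup>2 * z\<^sup>2 / b\<^sup>2))"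
      using lower le upper by order
    then show ?thesis
      by (subst (asm) ennreal_le_iff) (auto simp: Y_def intro!: add_nonneg_nonneg)
  qed
  have "X = 0"
  proof (rule ccontr)
    assume X: "X \<noteq> 0"
    \<comment> \<open>The three bounds make \<open>b\<close> admissible, give
      \<open>b \<le> b^2\<close>, and give \<open>b X^2 \<ge> 2\<close>, which exceeds
      \<open>z^2\<close>.\<close>
    define b where "b = max \<epsilon> (max 1 (2 / X\<^sup>2))"
    have "b * X\<^sup>2 \<ge> 2 / X\<^sup>2 * X\<^sup>2" by (rule mult_right_mono) (auto simp: b_def)
    then have bX: "b * X\<^sup>2 \<ge> 2" using X by simp
    have b1: "1 \<le> b" "\<epsilon> \<le> b" unfolding b_def by auto
    then have "b * X\<^sup>2 \<le> b\<^sup>2 * X\<^sup>2" by (intro mult_right_mono) (auto simp: power2_eq_square)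
    then have bX2: "2 \<le> b\<^sup>2 * X\<^sup>2" using bX by simp
    have z1: "z\<^sup>2 \<le> 1" unfolding z_def by simp
    \<comment> \<open>The surplus of the lower over the upper bound per unit of \<open>r^2\<close>;
      once it is positive, a large \<open>r\<close> beats the constant \<open>Y\<close>.\<close>
    define \<kappa> where "\<kappa> = (z\<^sup>2 + X\<^sup>2) / (1 + b\<^sup>2) - z\<^sup>2 / b\<^sup>2"
    have pos: "0 < b\<^sup>2" "0 < 1 + b\<^sup>2" using b1 by (auto intro: add_pos_nonneg)
    have "\<kappa> = (b\<^sup>2 * X\<^sup>2 - z\<^sup>2) / (b\<^sup>2 * (1 + b\<^sup>2))"
      unfolding \<kappa>_def using pos by (simp add: field_simps)
    then have \<kappa>: "0 < \<kappa>" using pos bX2 z1 by simp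
    define r where "r = max 1 ((Y + 1) / \<kappa>)"
    have "r\<^sup>2 * (z\<^sup>2 + X\<^sup>2) / (1 + b\<^sup>2) - r\<^sup>2 * z\<^sup>2 / b\<^sup>2 = r\<^sup>2 * \<kappa>"
      unfolding \<kappa>_def by (simp add: algebra_simps)
    then have "r\<^sup>2 * \<kappa> \<le> Y" using bound[OF b1(2), of r] by simp
    moreover have "r * \<kappa> \<le> r\<^sup>2 * \<kappa>"
      using \<kappa> by (intro mult_right_mono self_le_power) (auto simp: r_def)
    moreover have "Y + 1 \<le> r * \<kappa>"
    proof -
      have "(Y + 1) / \<kappa> * \<kappa> \<le> r * \<kappa>" using \<kappa> by (intro mult_right_mono) (auto simp: r_def)
      then show ?thesis using \<kappa> by simp
    qed
    ultimately show False by simp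
  qed
  then show ?case unfolding X_def \<delta>_def using Bi by simp
qed

text \<open>With \<open>w\<^sub>0 = B\<^sup>-\<^sup>1 D x\<^sub>0\<close> and all other rows silent, \<open>Gamma_Theta\<close> plays the unique
  optimum of a scalar linear quadratic problem.\<close>

lemma sink_markov_eq:
  assumes A: "A \<in> A_class n (adjacency_mat n EP)" and B: "B \<in> B_class n \<epsilon>" and D: "D \<in> D_class n"
    and i: "n - c \<le> i" "i < n" and m: "m < n"
  shows "markov (\<Gamma> A B D $$ (i, m)) k = markov (Gamma_Theta n c A B D $$ (i, m)) k"
  using m
proof (induction k arbitrary: m rule: less_induct)
  case (less k)
  \<comment> \<open>Here \<open>j\<close> collapses to \<open>i\<close>: the branch
    \<open>l = i\<close> comes first in the probe definitions, so \<open>r = 0\<close> and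
    \<open>b = \<epsilon>\<close> are mere fillers and all other rows of \<open>A\<close> become
    zero.\<close>
  let ?A = "probe_A n A i i 0" and ?B = "probe_B n \<epsilon> B i i \<epsilon>" and ?D = "probe_D n D i"
  let ?P = "(?A, ?B, ?D, unit_vec n m, probe_w n B D i m)"
  have "i = i \<or> (i, i) \<in> EP" by simp
  note pr = A B D i(2) i(2) less.prems order_refl this
  define a b where "a = A $$ (i, i)" and "b = B $$ (i, i)"
  define t where "t = lqr_t a b"
  define q where "q = (t - 1) / (b\<^sup>2 * t)"
  have b0: "b \<noteq> 0" unfolding b_def by (rule B_nonzero[OF pr])
  obtain x v x' v' where
    L: "loop_signals n ?P (\<Gamma> ?A ?B ?D) x v" and L': "loop_signals n ?P (Gamma_Theta n c ?A ?B ?D) x' v'"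
    and le: "signal_cost n x v \<le> signal_cost n x' v'"
    using probe_signals_le[OF pr] by blast
  note rs = probe_row_sum[OF pr]
  \<comment> \<open>The regulator is run on \<open>y\<close> because \<open>y 0\<close> may stem
    from another node \<open>m\<close>; \<open>y = a x\<close> holds only from time 1 on.\<close>
  define y where "y k = (\<Sum>l<n. A $$ (i, l) * x k l)" for k
  define y' where "y' k = (\<Sum>l<n. A $$ (i, l) * x' k l)" for k
  have Bi: "?B $$ (i, i) = b" unfolding b_def by (rule probe_B_i[OF pr])
  have gi: "gain n c ?A ?B i = 1 / t - 1"
    unfolding probe_gain[OF pr] t_def a_def b_def using i by (simp add: gain_def sink_gain_eq)
  have dyn: "x (Suc k) i = y k + b * v k i" and dyn': "x' (Suc k) i = y' k + b * v' k i" for k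
    using probe_state[OF pr L i(2)] probe_state[OF pr L' i(2)] rs[OF i(2)] Bi
    unfolding y_def y'_def by auto
  have y0: "y 0 = y' 0"
    unfolding y_def y'_def using probe_state_0[OF pr L] probe_state_0[OF pr L'] by (intro sum.cong) auto
  \<comment> \<open>For the competitor the premise \<open>eq\<close> is
    \<open>nonsink_markov_eq\<close>, applied to the probe plant itself.\<close>
  have idle: "x (Suc k) l = 0" if l: "l < n - c" and M: "M \<in> structured_design_methods n \<epsilon> EP EK EC"
    and loop: "loop_signals n ?P (M ?A ?B ?D) x v"
    and eq: "\<And>k q. q < n \<Longrightarrow>
      markov (M ?A ?B ?D $$ (l, q)) k = markov (Gamma_Theta n c ?A ?B ?D $$ (l, q)) k" for M x v l k
  proof -
    have l': "l < n" "l \<noteq> i" using l i by auto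
    have "?B $$ (l, l) * v k l = 0"
      using probe_response[OF pr loop l'(1) eq, of k] rs[OF l'(1)] l'(2) eq less.prems by simp
    then show ?thesis using probe_state[OF pr loop l'(1)] rs[OF l'(1)] l'(2) by simp
  qed
  have only_i: "(\<Sum>l<n. A $$ (i, l) * x l) = a * x i" if x0: "\<And>l. l < n - c \<Longrightarrow> x l = 0" for x :: "nat \<Rightarrow> real"
  proof -
    have "A $$ (i, l) * x l = 0" if l: "l < n" "l \<noteq> i" for l
    proof (cases "l < n - c")
      case False
      then have "(l, i) \<notin> EP" using sink l by auto
      then show ?thesis using A i l unfolding A_class_adjacency_iff by simp
    qed (simp add: x0)
    then have "(\<Sum>l<n. A $$ (i, l) * x l) = (\<Sum>l\<in>{i}. A $$ (i, l) * x l)"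
      using i by (intro sum.mono_neutral_right) auto
    then show ?thesis by (simp add: a_def)
  qed
  have yS: "y (Suc k) = a * x (Suc k) i" for k
    unfolding y_def
    by (rule only_i, rule idle[OF _ Gamma L])
      (simp_all add: nonsink_markov_eq[OF probe_A_class[OF pr] probe_B_class[OF pr] probe_D_class[OF pr]])
  have yS': "y' (Suc k) = a * x' (Suc k) i" for k
    unfolding y'_def by (rule only_i, rule idle[OF _ Theta L']) simp_all
  have resp': "?B $$ (l, l) * v' k l = gain n c ?A ?B l * (\<Sum>q<n. ?A $$ (l, q) * x' k q)" if "l < n" for l k
    using probe_response[OF pr L' that, of k] by simp
  have v'i: "v' k i = (1 / t - 1) / b * y' k" for k
    using resp'[OF i(2), of k] rs[OF i(2)] b0 unfolding Bi gi y'_def by (simp add: field_simps)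
  have qpos: "0 < q" unfolding q_def t_def by (rule lqr_square(1)[OF b0])
  have upper: "signal_cost n x' v' \<le> ennreal (1 + q * (y' 0)\<^sup>2)"
  proof -
    have "(\<Sum>k<N. \<Sum>l<n. (x' (Suc k) l)\<^sup>2 + (v' k l)\<^sup>2) \<le> q * (y' 0)\<^sup>2" for N
    proof -
      have "(\<Sum>l<n. (x' (Suc k) l)\<^sup>2 + (v' k l)\<^sup>2) = (\<Sum>l\<in>{i}. (x' (Suc k) l)\<^sup>2 + (v' k l)\<^sup>2)" for k
      proof (rule sum.mono_neutral_right)
        show "\<forall>l\<in>{..<n} - {i}. (x' (Suc k) l)\<^sup>2 + (v' k l)\<^sup>2 = 0"
        proof
          fix l assume "l \<in> {..<n} - {i}"
          then have l: "l < n" "l \<noteq> i" by auto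
          then have "v' k l = 0"
            using resp'[OF l(1), of k] rs[OF l(1)] probe_B_nonzero[OF pr l(1)] by simp
          then show "(x' (Suc k) l)\<^sup>2 + (v' k l)\<^sup>2 = 0"
            using probe_state[OF pr L' l(1), of k] rs[OF l(1)] l(2) by simp
        qed
      qed (use i in auto)
      then have "(\<Sum>k<N. \<Sum>l<n. (x' (Suc k) l)\<^sup>2 + (v' k l)\<^sup>2) = (\<Sum>k<N. (x' (Suc k) i)\<^sup>2 + (v' k i)\<^sup>2)"
        by simp
      also have "\<dots> = q * (y' 0)\<^sup>2 - q * (y' N)\<^sup>2 + t * (\<Sum>k<N. (v' k i - (1 / t - 1) / b * y' k)\<^sup>2)"
        unfolding q_def t_def by (rule lqr_telescope[where x = "\<lambda>k. x' k i" and v = "\<lambda>k. v' k i", OF b0 dyn' yS'])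
      also have "\<dots> \<le> q * (y' 0)\<^sup>2"
        using qpos unfolding v'i by simp
      finally show ?thesis .
    qed
    from signal_cost_le[OF this] show ?thesis unfolding probe_initial_cost[OF pr L'] .
  qed
  \<comment> \<open>Dropping the cost of all other nodes, the competitor still has to regulate node
    \<open>i\<close> within the optimal cost, which forces the optimal input.\<close>
  have "v k i = (1 / lqr_t a b - 1) / b * y k"
  proof (rule lqr_optimal_unique[where x = "\<lambda>k. x k i" and v = "\<lambda>k. v k i", OF b0 dyn yS])
    fix N
    have "ennreal ((\<Sum>l<n. (x 0 l)\<^sup>2) + (\<Sum>k<N. (x (Suc k) i)\<^sup>2 + (v k i)\<^sup>2)) \<le> ennreal (1 + q * (y' 0)\<^sup>2)"
      using signal_cost_ge[OF i(2), of "{..<N}" x v] le upper by (meson finite_lessThan order_trans)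
    then show "(\<Sum>k<N. (x (Suc k) i)\<^sup>2 + (v k i)\<^sup>2) \<le> (lqr_t a b - 1) / (b\<^sup>2 * lqr_t a b) * (y 0)\<^sup>2"
      unfolding probe_initial_cost[OF pr L] y0 q_def[unfolded t_def, symmetric]
      using qpos by (subst (asm) ennreal_le_iff) auto
  qed
  then have bv: "b * v k i = (1 / t - 1) * y k"
    unfolding t_def using b0 by simp
  \<comment> \<open>The same input from the Markov side: optimal feedback plus deviation. Comparing
    the two leaves a zero deviation.\<close>
  have "?B $$ (i, i) * v k i = gain n c ?A ?B i * (\<Sum>q<n. ?A $$ (i, q) * x k q) + ?B $$ (i, i) *
      (markov (\<Gamma> ?A ?B ?D $$ (i, m)) k - markov (Gamma_Theta n c ?A ?B ?D $$ (i, m)) k)"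
    by (rule probe_response[OF pr L i(2)])
      (simp only: probe_row_cong[OF pr Gamma] probe_row_cong[OF pr Theta] less.IH)
  then have "b * v k i = (1 / t - 1) * y k + b *
      (markov (\<Gamma> A B D $$ (i, m)) k - markov (Gamma_Theta n c A B D $$ (i, m)) k)"
    unfolding gi Bi probe_row_cong[OF pr Gamma less.prems] probe_row_cong[OF pr Theta less.prems]
    using rs[OF i(2)] by (simp add: y_def)
  then show ?case unfolding bv using b0 by simp
qed

text \<open>Equal Markov parameters make the competitor's signals solve the loop of
  \<open>Gamma_Theta\<close>, whose solution is unique, now for arbitrary \<open>x0\<close> and
  \<open>w0\<close>.\<close>

lemma cost_eq:
  assumes P: "(A, B, D, x0, w0) \<in> plants n \<epsilon> EP"
  shows "cost n (A, B, D, x0, w0) (\<Gamma> A B D) = cost n (A, B, D, x0, w0) (Gamma_Theta n c A B D)"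
proof -
  have cl: "A \<in> A_class n (adjacency_mat n EP)" "B \<in> B_class n \<epsilon>" "D \<in> D_class n"
    using P unfolding plants_def by auto
  obtain x v where L: "loop_signals n (A, B, D, x0, w0) (\<Gamma> A B D) x v"
    and c: "cost n (A, B, D, x0, w0) (\<Gamma> A B D) = signal_cost n x v"
    using structured_signals[OF Gamma P] by blast
  obtain x' v' where L': "loop_signals n (A, B, D, x0, w0) (Gamma_Theta n c A B D) x' v'"
    and c': "cost n (A, B, D, x0, w0) (Gamma_Theta n c A B D) = signal_cost n x' v'"
    using structured_signals[OF Theta P] by blast
  have "markov (\<Gamma> A B D $$ (i, m)) k = markov (Gamma_Theta n c A B D $$ (i, m)) k" if "i < n" "m < n" for i m k
    using nonsink_markov_eq[OF cl _ that(2)] sink_markov_eq[OF cl _ that] by (cases "i < n - c") auto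
  then have "markov_output n (\<Gamma> A B D) x k i = markov_output n (Gamma_Theta n c A B D) x k i" if "i < n" for k i
    unfolding markov_output_def using that by simp
  then have "loop_signals n (A, B, D, x0, w0) (Gamma_Theta n c A B D) x v"
    using L unfolding loop_signals_def by simp
  note u = loop_signals_unique[OF this L']
  have "(\<Sum>i<n. (x k i)\<^sup>2 + (v k i)\<^sup>2) = (\<Sum>i<n. (x' k i)\<^sup>2 + (v' k i)\<^sup>2)" for k
    using u by (intro sum.cong) auto
  then show ?thesis unfolding c c' signal_cost_def by simp
qed

end

theorem theorem4p7:
  fixes n c :: nat and \<epsilon> :: real and EP EK EC :: "(nat \<times> nat) set"
  assumes "2 \<le> n" and "0 < \<epsilon>"
    and "digraph_on n EP" and "digraph_on n EK" and "digraph_on n EC"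
    and "\<not> (\<exists>i. isolated_node n EP i)"
    and "all_self_loops n EK" and "all_self_loops n EC"
    and "c = card (sinks n EP)" and "1 \<le> c" and "sinks n EP = {n - c..<n}"
    and "totally_disconnected n EC"
    and "EP \<subseteq> EK"
  shows "undominated n \<epsilon> EP EK EC (Gamma_Theta n c)"
  unfolding undominated_def
proof
  have n: "0 < n" using assms(1) by simp
  show Theta: "Gamma_Theta n c \<in> structured_design_methods n \<epsilon> EP EK EC"
    by (rule Gamma_Theta_structured[OF n assms(2,7,12,13)])
  show "\<not> (\<exists>\<Gamma>\<in>structured_design_methods n \<epsilon> EP EK EC. dominates n \<epsilon> EP \<Gamma> (Gamma_Theta n c))"
  proof
    assume "\<exists>\<Gamma>\<in>structured_design_methods n \<epsilon> EP EK EC. dominates n \<epsilon> EP \<Gamma> (Gamma_Theta n c)"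
    then obtain \<Gamma> where \<Gamma>: "\<Gamma> \<in> structured_design_methods n \<epsilon> EP EK EC"
      and dom: "dominates n \<epsilon> EP \<Gamma> (Gamma_Theta n c)"
      by blast
    have "competitor n c \<epsilon> EP EK EC \<Gamma>"
    proof
      show "(i, l) \<notin> EP" if "n - c \<le> i" "i < n" "l \<noteq> i" for i l
      proof -
        have "i \<in> sinks n EP" using that assms(11) by simp
        then show ?thesis using that unfolding sinks_def by blast
      qed
      show "\<exists>j<n. j \<noteq> i \<and> (i, j) \<in> EP" if "i < n - c" for i
      proof -
        have "i \<notin> sinks n EP" "i < n" using that assms(11) by auto
        then obtain j where "j \<noteq> i" "(i, j) \<in> EP" unfolding sinks_def by blast
        then show ?thesis using assms(3) unfolding digraph_on_def by auto
      qed
      show "cost n (A, B, D, x0, w0) (\<Gamma> A B D) \<le> cost n (A, B, D, x0, w0) (Gamma_Theta n c A B D)"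
        if "(A, B, D, x0, w0) \<in> plants n \<epsilon> EP" for A B D x0 w0
        using dom that unfolding dominates_def by blast
    qed (fact n assms(2,12) Theta \<Gamma>)+
    then have "cost n (A, B, D, x0, w0) (\<Gamma> A B D) = cost n (A, B, D, x0, w0) (Gamma_Theta n c A B D)"
      if "(A, B, D, x0, w0) \<in> plants n \<epsilon> EP" for A B D x0 w0
      using competitor.cost_eq that by blast
    then show False
      using dom unfolding dominates_def by fastforce
  qed
qed

end
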